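(* There exists a randomized online algorithm $\mathcal{A}$ for the online knapsack problem in the random order model such that for every input $\mathcal{I}$, \[ \mathbb{E}[\mathcal{A}(\mathcal{I})] \geq \left(\frac{1}{6.65} - o(1)\right)\cdot \operatorname{OPT}(\mathcal{I}), \] i.e. $\mathcal{A}$ is $(1/6.65)$-competitive.
   Context: Online knapsack problem: a set of $n$ items $I=[n]$ is given, each item $i$ having a size $s_i\in\mathbb{Q}_{>0}$ and a profit $v_i\in\mathbb{Q}_{\ge 0}$, together with a knapsack capacity $W\in\mathbb{Q}_{>0}$ (with $s_i\le W$). A packing is a subset $M\subseteq I$ with $\sum_{i\in M}s_i\le W$; its profit is $\sum_{i\in M}v_i$. Items are revealed one per round; upon arrival of an item (with its size and profit) the algorithm must immediately and irrevocably decide whether to pack it. Random order model: the input sequence is a uniformly random permutation of the item set (the item set itself is chosen adversarially). $\mathcal{A}(\mathcal{I})$ denotes the profit of the algorithm's packing and $\operatorname{OPT}(\mathcal{I})$ the maximum profit of a packing of $\mathcal{I}$. The expectation is over the random permutation and the algorithm's internal randomness; the $o(1)$ term is with respect to $n\to\infty$. *)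

theory Defs
  imports
    "HOL-Probability.Probability"
    "HOL-Combinatorics.Multiset_Permutations"
    "HOL-Library.Landau_Symbols"
begin

definition knapsack_instance ::
  "nat \<Rightarrow> rat \<Rightarrow> (nat \<Rightarrow> rat) \<Rightarrow> (nat \<Rightarrow> rat) \<Rightarrow> bool" where
  "knapsack_instance n W s v \<longleftrightarrow>
     W > 0 \<and> (\<forall>i\<in>{1..n}. 0 < s i \<and> s i \<le> W \<and> 0 \<le> v i)"

definition is_packing :: "nat \<Rightarrow> rat \<Rightarrow> (nat \<Rightarrow> rat) \<Rightarrow> nat set \<Rightarrow> bool" where
  "is_packing n W s M \<longleftrightarrow> M \<subseteq> {1..n} \<and> (\<Sum>i\<in>M. s i) \<le> W"

definition profit :: "(nat \<Rightarrow> rat) \<Rightarrow> nat set \<Rightarrow> rat" where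
  "profit v M = (\<Sum>i\<in>M. v i)"

definition OPT :: "nat \<Rightarrow> rat \<Rightarrow> (nat \<Rightarrow> rat) \<Rightarrow> (nat \<Rightarrow> rat) \<Rightarrow> rat" where
  "OPT n W s v = Max (profit v ` {M. is_packing n W s M})"

text \<open>
  A deterministic decision rule gets the (size, profit) pairs of the items revealed in the earlier
  rounds, in order of arrival, and the pair of the current item; it answers whether to pack that
  item. It never sees item names. Its own earlier decisions need not be passed to it, as they are
  determined by the earlier items.
\<close>

type_synonym decision_rule = "(rat \<times> rat) list \<Rightarrow> rat \<times> rat \<Rightarrow> bool"

text \<open>
  The set of items packed by the rule \<open>D\<close> when the items arrive in the order given by the list
  \<open>\<pi>\<close> of item names.
\<close>

definition packed_items ::
  "decision_rule \<Rightarrow> (nat \<Rightarrow> rat) \<Rightarrow> (nat \<Rightarrow> rat) \<Rightarrow> nat list \<Rightarrow> nat set" where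
  "packed_items D s v \<pi> =
     {\<pi> ! t | t. t < length \<pi> \<and>
        D (map (\<lambda>j. (s j, v j)) (take t \<pi>)) (s (\<pi> ! t), v (\<pi> ! t))}"

text \<open>
  A randomized online algorithm is a probability distribution over decision rules; it knows the
  number \<open>n\<close> of items and the capacity \<open>W\<close> in advance. For every outcome of its internal
  randomness, every input and every arrival order it has to produce a packing.
\<close>

type_synonym randomized_algorithm = "nat \<Rightarrow> rat \<Rightarrow> decision_rule pmf"

definition online_knapsack_algorithm :: "randomized_algorithm \<Rightarrow> bool" where
  "online_knapsack_algorithm A \<longleftrightarrow>
     (\<forall>n W s v. knapsack_instance n W s v \<longrightarrow>
        (\<forall>D\<in>set_pmf (A n W). \<forall>\<pi>\<in>permutations_of_set {1..n}.
           is_packing n W s (packed_items D s v \<pi>)))"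

text \<open>
  The arrival order is uniformly random and independent of the internal randomness.
\<close>

definition expected_profit ::
  "randomized_algorithm \<Rightarrow> nat \<Rightarrow> rat \<Rightarrow> (nat \<Rightarrow> rat) \<Rightarrow> (nat \<Rightarrow> rat) \<Rightarrow> real" where
  "expected_profit A n W s v =
     measure_pmf.expectation (pair_pmf (A n W) (pmf_of_set (permutations_of_set {1..n})))
       (\<lambda>(D, \<pi>). real_of_rat (profit v (packed_items D s v \<pi>)))"

end

theory Submission
  imports Defs
begin

text \<open>
  The algorithm works in three phases. It rejects the first \<open>0.42291 n\<close> items. Up to round
  \<open>0.6457 n\<close> it packs, as long as they fit, the large items (of size more than \<open>W / 3\<close>) that beat
  every large item of the sample. If that has packed nothing, then from that round on it packs the
  current item whenever it is small, belongs to an optimal packing of the small items seen so far,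
  and fits.

  At most two large items fit together. If the optimum contains the two best large items, the first
  and the second large item packed both count; otherwise the profit of its large items is at most
  that of the best and the third best, and the first one packed suffices. A small item drawn in
  round \<open>l\<close> has expected profit at least \<open>1 / n\<close> of the small part of the optimum and expected size
  at most \<open>W / l\<close>, so by Markov's inequality there is room for it with probability at least
  \<open>1 - 3 / 2 ln (x / 0.6457)\<close> at \<open>l = x n\<close>; and no large item has been packed with probability at least
  \<open>0.42291 / 0.6457\<close>, whatever happens after the second phase.

  Both the best items and the optimal packings have to be unique functions of the set of items seen.
  Ties are broken by names, but the rules do not see names: the algorithm attaches a random
  permutation of \<open>{1..n}\<close> to the rounds and uses it instead, which amounts to renaming the items by a
  permutation that is independent of the arrival order.
\<close>

subsection \<open>Averages over permutations and subsets\<close>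

text \<open>Expectation over a uniformly random order, kept as an elementary finite sum; the passage
  from probability mass functions is made once, in \<open>expected_profit_tagged\<close>.\<close>

definition perm_avg :: "'a set \<Rightarrow> ('a list \<Rightarrow> real) \<Rightarrow> real" where
  "perm_avg Y f = (\<Sum>ys\<in>permutations_of_set Y. f ys) / fact (card Y)"

definition subset_avg :: "'a set \<Rightarrow> nat \<Rightarrow> ('a set \<Rightarrow> real) \<Rightarrow> real" where
  "subset_avg X l h = (\<Sum>S | S \<subseteq> X \<and> card S = l. h S) / real (card X choose l)"

lemma perm_avg_mono:
  assumes "\<And>ys. distinct ys \<Longrightarrow> set ys = Y \<Longrightarrow> f ys \<le> g ys"
  shows "perm_avg Y f \<le> perm_avg Y g"
  unfolding perm_avg_def
  by (intro divide_right_mono sum_mono) (auto simp: permutations_of_set_def intro: assms)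

lemma perm_avg_cong:
  assumes "\<And>ys. distinct ys \<Longrightarrow> set ys = Y \<Longrightarrow> f ys = g ys"
  shows "perm_avg Y f = perm_avg Y g"
  by (intro antisym perm_avg_mono) (simp_all add: assms)

lemma perm_avg_add: "perm_avg Y (\<lambda>ys. f ys + g ys) = perm_avg Y f + perm_avg Y g"
  by (simp add: perm_avg_def sum.distrib add_divide_distrib)

lemma perm_avg_diff: "perm_avg Y (\<lambda>ys. f ys - g ys) = perm_avg Y f - perm_avg Y g"
  by (simp add: perm_avg_def sum_subtractf diff_divide_distrib)

lemma perm_avg_mult: "perm_avg Y (\<lambda>ys. c * f ys) = c * perm_avg Y f"
  by (simp add: perm_avg_def sum_distrib_left)

lemma perm_avg_sum: "perm_avg Y (\<lambda>ys. \<Sum>i\<in>I. f i ys) = (\<Sum>i\<in>I. perm_avg Y (f i))"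
  by (simp add: perm_avg_def sum.swap[of _ I] sum_divide_distrib)

lemma perm_avg_const: "finite Y \<Longrightarrow> perm_avg Y (\<lambda>_. c) = c"
  by (simp add: perm_avg_def)

lemma perm_avg_nonneg:
  "(\<And>ys. distinct ys \<Longrightarrow> set ys = Y \<Longrightarrow> 0 \<le> f ys) \<Longrightarrow> 0 \<le> perm_avg Y f"
  unfolding perm_avg_def by (intro divide_nonneg_nonneg sum_nonneg) (auto simp: permutations_of_set_def)

text \<open>Conditioning on the head: it is uniform in \<open>Y\<close>, and the rest is a uniformly
  random order of the other elements. As lists hold the latest arrival first, this conditions on the
  last arrival and drives the inductions over time.\<close>

lemma perm_avg_Cons:
  assumes "finite Y" "Y \<noteq> {}"
  shows "perm_avg Y f = (\<Sum>x\<in>Y. perm_avg (Y - {x}) (\<lambda>ys. f (x # ys))) / card Y"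
proof -
  have "(\<Sum>ys\<in>permutations_of_set Y. f ys) =
        (\<Sum>x\<in>Y. \<Sum>ys\<in>(#) x ` permutations_of_set (Y - {x}). f ys)"
    unfolding permutations_of_set_nonempty[OF assms(2)] using assms
    by (subst sum.UNION_disjoint) auto
  also have "\<dots> = (\<Sum>x\<in>Y. \<Sum>ys\<in>permutations_of_set (Y - {x}). f (x # ys))"
    by (rule sum.cong[OF refl], subst sum.reindex) (auto simp: inj_on_def)
  finally have *: "(\<Sum>ys\<in>permutations_of_set Y. f ys) =
      (\<Sum>x\<in>Y. \<Sum>ys\<in>permutations_of_set (Y - {x}). f (x # ys))" .
  obtain m where m: "card Y = Suc m" using assms by (metis card_gt_0_iff gr0_conv_Suc)
  then show ?thesis using assms
    by (simp add: perm_avg_def * sum_divide_distrib field_simps)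
qed

lemma subset_avg_mono:
  assumes "\<And>S. S \<subseteq> X \<Longrightarrow> card S = l \<Longrightarrow> f S \<le> g S"
  shows "subset_avg X l f \<le> subset_avg X l g"
  unfolding subset_avg_def by (intro divide_right_mono sum_mono) (auto simp: assms)

lemma subset_avg_add: "subset_avg X l (\<lambda>S. f S + g S) = subset_avg X l f + subset_avg X l g"
  by (simp add: subset_avg_def sum.distrib add_divide_distrib)

lemma subset_avg_diff: "subset_avg X l (\<lambda>S. f S - g S) = subset_avg X l f - subset_avg X l g"
  by (simp add: subset_avg_def sum_subtractf diff_divide_distrib)

lemma subset_avg_mult: "subset_avg X l (\<lambda>S. c * f S) = c * subset_avg X l f"
  by (simp add: subset_avg_def sum_distrib_left)

lemma subset_avg_sum: "subset_avg X l (\<lambda>S. \<Sum>i\<in>I. f i S) = (\<Sum>i\<in>I. subset_avg X l (f i))"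
  by (simp add: subset_avg_def sum.swap[of _ I] sum_divide_distrib)

lemma subset_avg_const: "finite X \<Longrightarrow> l \<le> card X \<Longrightarrow> subset_avg X l (\<lambda>_. c) = c"
  by (simp add: subset_avg_def n_subsets)

lemma subset_avg_disjoint:
  assumes "finite X" "Z \<subseteq> X"
  shows "subset_avg X l (\<lambda>S. of_bool (S \<inter> Z = {})) =
    real (card X - card Z choose l) / real (card X choose l)"
proof -
  have "(\<Sum>S | S \<subseteq> X \<and> card S = l. of_bool (S \<inter> Z = {}) :: real) =
    real (card {S. S \<subseteq> X - Z \<and> card S = l})"
    using assms by (subst sum_of_bool_eq) (auto intro!: arg_cong[of _ _ card])
  also have "\<dots> = real (card X - card Z choose l)"
    using assms by (simp add: n_subsets card_Diff_subset finite_subset)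
  finally show ?thesis by (simp add: subset_avg_def)
qed

text \<open>The last \<open>l\<close> entries of a random order are a uniformly random
  \<open>l\<close>-subset in uniformly random order. The induction is on the number of entries
  dropped.\<close>

lemma perm_avg_drop:
  assumes "finite X" "l \<le> card X"
  shows "perm_avg X (\<lambda>ys. f (drop (card X - l) ys)) = subset_avg X l (\<lambda>S. perm_avg S f)"
  using assms
proof (induction "card X - l" arbitrary: X)
  case 0
  then have l: "l = card X" by simp
  have "{S. S \<subseteq> X \<and> card S = l} = {X}"
    using 0 l by (auto dest: card_subset_eq)
  then show ?case by (simp add: subset_avg_def l)
next
  case (Suc k)
  have X: "X \<noteq> {}" "finite X" "card X = Suc (k + l)" using Suc by auto
  have "perm_avg X (\<lambda>ys. f (drop (card X - l) ys)) =
        (\<Sum>x\<in>X. perm_avg (X - {x}) (\<lambda>ys. f (drop (card (X - {x}) - l) ys))) / card X"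
    using X by (subst perm_avg_Cons) auto
  also have "\<dots> = (\<Sum>x\<in>X. subset_avg (X - {x}) l (\<lambda>S. perm_avg S f)) / card X"
    using X Suc.hyps(2)
    by (intro arg_cong2[of _ _ _ _ "(/)"] sum.cong refl Suc.hyps(1)) auto
  also have "\<dots> = (\<Sum>x\<in>X. \<Sum>S | S \<subseteq> X - {x} \<and> card S = l. perm_avg S f) /
      (real (k + l choose l) * card X)"
    using X by (simp add: subset_avg_def sum_divide_distrib)
  \<comment> \<open>Double counting: each \<open>l\<close>-subset \<open>S\<close> of
    \<open>X\<close> arises from every head \<open>x\<close> outside it, and there are
    \<open>Suc k\<close> of these.\<close>
  also have "(\<Sum>x\<in>X. \<Sum>S | S \<subseteq> X - {x} \<and> card S = l. perm_avg S f) =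
     (\<Sum>x\<in>X. \<Sum>S | (S \<subseteq> X \<and> card S = l) \<and> x \<notin> S. perm_avg S f)"
    by (intro sum.cong) auto
  also have "\<dots> = (\<Sum>S | S \<subseteq> X \<and> card S = l. \<Sum>x | x \<in> X \<and> x \<notin> S. perm_avg S f)"
    using X by (subst sum.swap_restrict) (auto simp: conj_commute)
  also have "\<dots> = (\<Sum>S | S \<subseteq> X \<and> card S = l. real (Suc k) * perm_avg S f)"
  proof (intro sum.cong refl)
    fix S assume "S \<in> {S. S \<subseteq> X \<and> card S = l}"
    then have "card {x \<in> X. x \<notin> S} = Suc k"
      using X by (auto simp: set_diff_eq[symmetric] card_Diff_subset finite_subset)
    then show "(\<Sum>x | x \<in> X \<and> x \<notin> S. perm_avg S f) = real (Suc k) * perm_avg S f" by simp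
  qed
  also have "\<dots> = real (Suc k) * (\<Sum>S | S \<subseteq> X \<and> card S = l. perm_avg S f)"
    by (simp add: sum_distrib_left)
  also have "\<dots> / (real (k + l choose l) * card X) = subset_avg X l (\<lambda>S. perm_avg S f)"
  proof -
    have "Suc k * (Suc (k + l) choose Suc k) = Suc (k + l) * (k + l choose k)"
      by (rule Suc_times_binomial)
    then have "real (Suc k) * real (Suc (k + l) choose l) = real (Suc (k + l)) * real (k + l choose l)"
      by (metis binomial_symmetric add_diff_cancel_right' le_add1 le_add2 add_Suc add_diff_cancel_left' of_nat_mult)
    then show ?thesis using X by (simp add: subset_avg_def field_simps del: of_nat_Suc)
  qed
  finally show ?case .
qed

section \<open>Probabilities of missing or sampling given items\<close>

lemma binomial_quotient_1:
  assumes "l \<le> n" "n \<ge> 1"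
  shows "real (n - 1 choose l) / real (n choose l) = (real n - l) / n"
proof -
  obtain m where m: "n = Suc m" using assms by (metis Suc_le_D One_nat_def)
  show ?thesis
  proof (cases "l = n")
    case False
    then have "(n - l) * (n choose l) = n * (n - 1 choose l)"
      using m by (metis binomial_absorb_comp)
    then have "(real n - l) * (n choose l) = n * real (n - 1 choose l)"
      using assms by (metis of_nat_mult of_nat_diff)
    then show ?thesis using assms by (simp add: field_simps)
  qed (use m in auto)
qed

lemma binomial_quotient_2:
  assumes "l \<le> n" "n \<ge> 2"
  shows "real (n - 2 choose l) / real (n choose l) =
    (real n - l) * (real n - l - 1) / (real n * (real n - 1))"
proof (cases "l \<le> n - 1")
  case True
  have "real (n - 2 choose l) / real (n choose l) =
    (real (n - 1 - 1 choose l) / real (n - 1 choose l)) * (real (n - 1 choose l) / real (n choose l))"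
    using True by (simp add: numeral_2_eq_2)
  also have "\<dots> = ((real (n - 1) - l) / real (n - 1)) * ((real n - l) / n)"
    using True assms by (subst (1 2) binomial_quotient_1) auto
  finally show ?thesis using assms by (simp add: of_nat_diff algebra_simps)
next
  case False
  then have "l = n" using assms by simp
  then show ?thesis using assms by simp
qed

text \<open>Drawing without replacement: each later factor \<open>(n - l - j) / (n - j)\<close> is
  at most the first, \<open>(n - l) / n\<close>. An upper bound suffices because missing all three
  items is an event to be subtracted.\<close>

lemma binomial_quotient_3:
  assumes "l \<le> n" "n \<ge> 3"
  shows "real (n - 3 choose l) / real (n choose l) \<le> ((real n - l) / n) ^ 3"
proof (cases "l \<le> n - 2")
  case True
  have q: "(real n - real l - j) / (real n - j) \<le> (real n - l) / n" "(real n - real l - j) / (real n - j) \<ge> 0"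
    if "j \<in> {1, 2}" for j :: real
    using that True assms by (auto simp: field_simps of_nat_diff)
  have "real (n - 3 choose l) / real (n choose l) =
    (real (n - 2 - 1 choose l) / real (n - 2 choose l)) * (real (n - 2 choose l) / real (n choose l))"
    using True by (simp add: numeral_2_eq_2 numeral_3_eq_3)
  also have "\<dots> = ((real n - l - 2) / (real n - 2)) * (((real n - l - 1) / (real n - 1)) * ((real n - l) / n))"
    using True assms
    by (subst binomial_quotient_1, simp, simp, subst binomial_quotient_2)
       (auto simp: of_nat_diff algebra_simps)
  also have "\<dots> \<le> ((real n - l) / n) * (((real n - l) / n) * ((real n - l) / n))"
    using q[of 1] q[of 2] assms
    by (intro mult_mono mult_nonneg_nonneg) auto
  finally show ?thesis by (simp add: power3_eq_cube)
next
  case False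
  then have "n - 3 < l" using assms by auto
  then have "real (n - 3 choose l) / real (n choose l) = 0" by simp
  moreover have "((real n - l) / n) ^ 3 \<ge> 0" using assms by (intro zero_le_power) auto
  ultimately show ?thesis by linarith
qed

text \<open>\<open>drop (card Y - a) ys\<close> is the sample, that is the first \<open>a\<close>
  arrivals; by \<open>perm_avg_drop\<close> its set is a uniformly random
  \<open>a\<close>-subset.\<close>

lemma perm_avg_sample_disjoint:
  assumes "finite Y" "Z \<subseteq> Y" "a \<le> card Y"
  shows "perm_avg Y (\<lambda>ys. of_bool (set (drop (card Y - a) ys) \<inter> Z = {})) =
    real (card Y - card Z choose a) / real (card Y choose a)"
proof -
  have "perm_avg Y (\<lambda>ys. of_bool (set (drop (card Y - a) ys) \<inter> Z = {})) =
     subset_avg Y a (\<lambda>S. perm_avg S (\<lambda>ys. of_bool (set ys \<inter> Z = {})))"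
    using assms by (intro perm_avg_drop) auto
  also have "\<dots> = subset_avg Y a (\<lambda>S. of_bool (S \<inter> Z = {}))"
  proof -
    have "perm_avg S (\<lambda>ys. of_bool (set ys \<inter> Z = {})) = of_bool (S \<inter> Z = {})" if "S \<subseteq> Y" for S
    proof -
      have "perm_avg S (\<lambda>ys. of_bool (set ys \<inter> Z = {})) = perm_avg S (\<lambda>ys. of_bool (S \<inter> Z = {}))"
        by (rule perm_avg_cong) auto
      then show ?thesis using that assms by (simp add: perm_avg_const finite_subset)
    qed
    then show ?thesis unfolding subset_avg_def by (intro arg_cong2[of _ _ _ _ "(/)"] sum.cong) auto
  qed
  finally show ?thesis using assms by (simp add: subset_avg_disjoint)
qed

lemma perm_avg_sample_mem:
  assumes "finite Y" "z \<in> Y" "a \<le> card Y"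
  shows "perm_avg Y (\<lambda>ys. of_bool (z \<in> set (drop (card Y - a) ys))) = a / card Y"
proof -
  have "card Y > 0" using assms by (auto simp: card_gt_0_iff)
  have "perm_avg Y (\<lambda>ys. of_bool (z \<in> set (drop (card Y - a) ys))) =
    perm_avg Y (\<lambda>ys. 1 - of_bool (set (drop (card Y - a) ys) \<inter> {z} = {}))"
    by (rule perm_avg_cong) auto
  also have "\<dots> = 1 - (real (card Y) - a) / card Y"
    using assms \<open>card Y > 0\<close> perm_avg_sample_disjoint[of Y "{z}" a]
      binomial_quotient_1[of a "card Y"]
    by (simp add: perm_avg_diff perm_avg_const)
  finally show ?thesis using \<open>card Y > 0\<close> by (simp add: field_simps)
qed

text \<open>Missing \<open>y\<close> splits into missing both items and the event in question, which
  is therefore a difference of two instances of \<open>perm_avg_sample_disjoint\<close>.\<close>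

lemma perm_avg_sample_mem_nmem:
  assumes "finite Y" "z \<in> Y" "y \<in> Y" "y \<noteq> z" "a \<le> card Y"
  shows "perm_avg Y (\<lambda>ys. of_bool (y \<notin> set (drop (card Y - a) ys) \<and> z \<in> set (drop (card Y - a) ys))) =
    (real (card Y) - a) * a / (real (card Y) * (real (card Y) - 1))"
proof -
  have c: "card Y \<ge> 2"
    using card_mono[of Y "{y, z}"] assms by auto
  let ?f = "\<lambda>Z ys. of_bool (set (drop (card Y - a) ys) \<inter> Z = {}) :: real"
  have "perm_avg Y (\<lambda>ys. of_bool (y \<notin> set (drop (card Y - a) ys) \<and> z \<in> set (drop (card Y - a) ys))) =
    perm_avg Y (\<lambda>ys. ?f {y} ys - ?f {y, z} ys)"
    by (rule perm_avg_cong) auto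
  also have "\<dots> = (real (card Y) - a) / card Y -
      (real (card Y) - a) * (real (card Y) - a - 1) / (real (card Y) * (real (card Y) - 1))"
    using assms c perm_avg_sample_disjoint[of Y "{y}" a] perm_avg_sample_disjoint[of Y "{y, z}" a]
      binomial_quotient_1[of a "card Y"] binomial_quotient_2[of a "card Y"]
    by (simp add: perm_avg_diff numeral_2_eq_2)
  also have "\<dots> = (real (card Y) - a) * a / (real (card Y) * (real (card Y) - 1))"
  proof -
    have "real (card Y) - 1 \<noteq> 0" "real (card Y) \<noteq> 0" using c by auto
    then show ?thesis by (simp add: divide_simps) (simp add: algebra_simps)
  qed
  finally show ?thesis .
qed

subsection \<open>The algorithm on named items\<close>

definition beats :: "('a::linorder \<Rightarrow> real) \<Rightarrow> 'a \<Rightarrow> 'a \<Rightarrow> bool" where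
  "beats v x y \<longleftrightarrow> v y < v x \<or> v y = v x \<and> x < y"

lemma beats_trans: "beats v x y \<Longrightarrow> beats v y z \<Longrightarrow> beats v x z"
  by (auto simp: beats_def)

lemma beats_asym: "beats v x y \<Longrightarrow> \<not> beats v y x"
  by (auto simp: beats_def)

lemma beats_total: "x \<noteq> y \<Longrightarrow> beats v x y \<or> beats v y x"
  by (auto simp: beats_def)

lemma beats_imp_ge: "beats v x y \<Longrightarrow> v y \<le> v x"
  by (auto simp: beats_def)

lemma exists_best:
  assumes "finite B" "B \<noteq> {}"
  obtains z where "z \<in> B" "\<And>w. w \<in> B \<Longrightarrow> w \<noteq> z \<Longrightarrow> beats v z w"
proof -
  have "\<exists>z\<in>B. \<forall>w\<in>B. w \<noteq> z \<longrightarrow> beats v z w"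
    using assms
  proof (induction rule: finite_ne_induct)
    case (insert x F)
    then obtain z where z: "z \<in> F" "\<forall>w\<in>F. w \<noteq> z \<longrightarrow> beats v z w" by auto
    show ?case
    proof (cases "beats v x z")
      case True
      then have "\<forall>w\<in>F. beats v x w" using z(2) beats_trans by metis
      then show ?thesis by auto
    next
      case False
      then have "beats v z x" using beats_total[of x z v] z(1) insert.hyps by auto
      then show ?thesis using z by auto
    qed
  qed auto
  then show thesis using that by blast
qed

text \<open>The choice is a function of the set \<open>S\<close> alone. Hence, given the set of
  arrivals, the latest one is uniform in it and independent of the packing chosen.\<close>

definition opt_packing :: "real \<Rightarrow> ('a \<Rightarrow> real) \<Rightarrow> ('a \<Rightarrow> real) \<Rightarrow> 'a set \<Rightarrow> 'a set" where
  "opt_packing W s v S = (SOME M. M \<subseteq> S \<and> sum s M \<le> W \<and>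
     (\<forall>M'. M' \<subseteq> S \<and> sum s M' \<le> W \<longrightarrow> sum v M' \<le> sum v M))"

lemma opt_packing:
  assumes "finite S" "0 \<le> W"
  shows "opt_packing W s v S \<subseteq> S" "sum s (opt_packing W s v S) \<le> W"
    "M' \<subseteq> S \<Longrightarrow> sum s M' \<le> W \<Longrightarrow> sum v M' \<le> sum v (opt_packing W s v S)"
proof -
  let ?F = "{M. M \<subseteq> S \<and> sum s M \<le> W}"
  have "finite ?F" "{} \<in> ?F" using assms by auto
  then have "finite (sum v ` ?F)" "sum v ` ?F \<noteq> {}" by blast+
  then have "Max (sum v ` ?F) \<in> sum v ` ?F" "\<forall>M'\<in>?F. sum v M' \<le> Max (sum v ` ?F)"
    by (auto intro: Max_in)
  then have "\<exists>M. M \<subseteq> S \<and> sum s M \<le> W \<and> (\<forall>M'. M' \<subseteq> S \<and> sum s M' \<le> W \<longrightarrow> sum v M' \<le> sum v M)"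
    by (auto simp: image_iff)
  from someI_ex[OF this] show "opt_packing W s v S \<subseteq> S" "sum s (opt_packing W s v S) \<le> W"
    "M' \<subseteq> S \<Longrightarrow> sum s M' \<le> W \<Longrightarrow> sum v M' \<le> sum v (opt_packing W s v S)"
    unfolding opt_packing_def by blast+
qed

text \<open>The predicates under \<open>SOME\<close> coincide, so the same packing is chosen even
  among several optima.\<close>

lemma opt_packing_cong:
  assumes "\<And>i. i \<in> S \<Longrightarrow> s i = s' i" "\<And>i. i \<in> S \<Longrightarrow> v i = v' i"
  shows "opt_packing W s v S = opt_packing W s' v' S"
proof -
  have "sum s M = sum s' M" "sum v M = sum v' M" if "M \<subseteq> S" for M
    using that assms by (auto intro!: sum.cong)
  then show ?thesis unfolding opt_packing_def
    by (intro arg_cong[of _ _ Eps] ext) (metis (no_types, lifting))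
qed

text \<open>The current round is \<open>length ys + 1\<close>: large items can be packed in rounds
  \<open>a + 1\<close> to \<open>b\<close>, small ones from \<open>b + 1\<close> on. A large item is
  compared with the sample only, so one that is worse than an item packed earlier can still be
  packed second.\<close>

definition accepts ::
  "nat \<Rightarrow> nat \<Rightarrow> real \<Rightarrow> ('a::linorder \<Rightarrow> real) \<Rightarrow> ('a \<Rightarrow> real) \<Rightarrow> 'a set \<Rightarrow> 'a list \<Rightarrow> 'a \<Rightarrow> bool" where
  "accepts a b W s v P ys x \<longleftrightarrow> sum s P + s x \<le> W \<and>
     (if W < 3 * s x
      then a \<le> length ys \<and> length ys < b \<and>
        (\<forall>y\<in>set (drop (length ys - a) ys). W < 3 * s y \<longrightarrow> beats v x y)
      else b \<le> length ys \<and> x \<in> opt_packing W s v {i \<in> set (x # ys). 3 * s i \<le> W} \<and>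
        (\<forall>y\<in>P. 3 * s y \<le> W))"

text \<open>The list holds the items seen so far, the most recent one first; thus \<open>drop (length ys - a) ys\<close> is
  the sample.\<close>

primrec run ::
  "nat \<Rightarrow> nat \<Rightarrow> real \<Rightarrow> ('a::linorder \<Rightarrow> real) \<Rightarrow> ('a \<Rightarrow> real) \<Rightarrow> 'a list \<Rightarrow> 'a set" where
  "run a b W s v [] = {}"
| "run a b W s v (x # ys) =
     (if accepts a b W s v (run a b W s v ys) ys x then insert x (run a b W s v ys)
      else run a b W s v ys)"

lemma run_subset: "run a b W s v ys \<subseteq> set ys"
  by (induction ys) auto

lemma finite_run [simp]: "finite (run a b W s v ys)"
  by (rule finite_subset[OF run_subset]) simp

text \<open>A decision rule knows sizes and profits of the revealed items only, so the decision must
  not depend on the values of \<open>s\<close> and \<open>v\<close> elsewhere.\<close>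

lemma accepts_cong:
  assumes "\<And>i. i \<in> set (x # ys) \<Longrightarrow> s i = s' i" "\<And>i. i \<in> set (x # ys) \<Longrightarrow> v i = v' i" "P \<subseteq> set ys"
  shows "accepts a b W s v P ys x = accepts a b W s' v' P ys x"
proof -
  have 1: "sum s P = sum s' P" using assms by (auto intro!: sum.cong)
  have 2: "{i \<in> set (x # ys). 3 * s i \<le> W} = {i \<in> set (x # ys). 3 * s' i \<le> W}"
    using assms(1) by (metis (no_types, lifting))
  have 3: "opt_packing W s v {i \<in> set (x # ys). 3 * s' i \<le> W} =
        opt_packing W s' v' {i \<in> set (x # ys). 3 * s' i \<le> W}"
    using assms by (intro opt_packing_cong) blast+
  have 4: "s x = s' x" using assms by simp
  have 5: "(\<forall>y\<in>P. 3 * s y \<le> W) = (\<forall>y\<in>P. 3 * s' y \<le> W)"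
    using assms by (metis list.set_intros(2) subsetD)
  have 6: "(\<forall>y\<in>set (drop (length ys - a) ys). W < 3 * s y \<longrightarrow> beats v x y) =
      (\<forall>y\<in>set (drop (length ys - a) ys). W < 3 * s' y \<longrightarrow> beats v' x y)"
    using assms unfolding beats_def by (metis in_set_dropD list.set_intros)
  show ?thesis unfolding accepts_def 1 2 3 4 5 6 ..
qed

lemma run_cong:
  assumes "\<And>i. i \<in> set ys \<Longrightarrow> s i = s' i" "\<And>i. i \<in> set ys \<Longrightarrow> v i = v' i"
  shows "run a b W s v ys = run a b W s' v' ys"
  using assms
proof (induction ys)
  case (Cons x ys)
  then have "run a b W s v ys = run a b W s' v' ys" by simp
  moreover have "accepts a b W s v (run a b W s' v' ys) ys x = accepts a b W s' v' (run a b W s' v' ys) ys x"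
    using Cons.prems by (intro accepts_cong run_subset) auto
  ultimately show ?case by simp
qed simp

lemma sum_run_le:
  assumes "distinct ys" "0 \<le> W"
  shows "sum s (run a b W s v ys) \<le> W"
  using assms
proof (induction ys)
  case (Cons x ys)
  then have "x \<notin> run a b W s v ys" using run_subset by fastforce
  then show ?case using Cons by (auto simp: accepts_def)
qed simp

primrec gain ::
  "nat \<Rightarrow> nat \<Rightarrow> real \<Rightarrow> ('a::linorder \<Rightarrow> real) \<Rightarrow> ('a \<Rightarrow> real) \<Rightarrow> 'a list \<Rightarrow> real" where
  "gain a b W s v [] = 0"
| "gain a b W s v (x # ys) = v x * of_bool (accepts a b W s v (run a b W s v ys) ys x)"

lemma sum_run_eq_gain:
  assumes "distinct ys"
  shows "sum v (run a b W s v ys) = (\<Sum>k<length ys. gain a b W s v (drop k ys))"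
  using assms
proof (induction ys)
  case (Cons x ys)
  then have "x \<notin> run a b W s v ys" using run_subset by fastforce
  then show ?case using Cons by (simp add: sum.lessThan_Suc_shift del: sum.lessThan_Suc)
qed simp

lemma perm_avg_gain:
  assumes "finite S" "S \<noteq> {}"
  shows "perm_avg S (gain a b W s v) = (\<Sum>x\<in>S. v x * perm_avg (S - {x})
     (\<lambda>ys. of_bool (accepts a b W s v (run a b W s v ys) ys x))) / card S"
  using assms by (simp add: perm_avg_Cons perm_avg_mult)

subsection \<open>Large items\<close>

text \<open>The items that the second phase cannot pack: those in the sample, and those that do not beat it.\<close>

definition blocked ::
  "nat \<Rightarrow> real \<Rightarrow> ('a::linorder \<Rightarrow> real) \<Rightarrow> ('a \<Rightarrow> real) \<Rightarrow> 'a list \<Rightarrow> 'a \<Rightarrow> bool" where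
  "blocked a W s v ys w \<longleftrightarrow>
     (\<exists>z\<in>set (drop (length ys - a) ys). W < 3 * s z \<and> (z = w \<or> beats v z w))"

text \<open>The sample consists of the oldest entries, so it no longer changes once \<open>a\<close>
  items have arrived.\<close>

lemma blocked_Cons:
  assumes "a \<le> length ys"
  shows "blocked a W s v (x # ys) w = blocked a W s v ys w"
  using assms by (simp add: blocked_def Suc_diff_le)

lemma blocked_short:
  assumes "length ys \<le> a" "w \<in> set ys" "W < 3 * s w"
  shows "blocked a W s v ys w"
  using assms by (auto simp: blocked_def)

text \<open>A sampled large \<open>z\<close> is \<open>x\<close> or beats it. By distinctness it is
  not \<open>x\<close>, and beating \<open>x\<close> contradicts acceptance. Small items are
  excluded by \<open>length ys < b\<close>.\<close>

lemma not_accepts_blocked: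
  assumes "length ys < b" "distinct (x # ys)" "W < 3 * s x \<Longrightarrow> blocked a W s v (x # ys) x"
  shows "\<not> accepts a b W s v P ys x"
proof
  assume acc: "accepts a b W s v P ys x"
  with assms(1) have x: "W < 3 * s x" "a \<le> length ys"
    "\<forall>y\<in>set (drop (length ys - a) ys). W < 3 * s y \<longrightarrow> beats v x y"
    by (auto simp: accepts_def split: if_splits)
  then have "blocked a W s v ys x" using assms by (simp add: blocked_Cons)
  then obtain z where z: "z \<in> set (drop (length ys - a) ys)" "W < 3 * s z" "z = x \<or> beats v z x"
    by (auto simp: blocked_def)
  then have "z \<noteq> x" using assms(2) in_set_dropD by fastforce
  then show False using z x beats_asym by blast
qed

text \<open>Up to round \<open>b\<close> only large items that are not blocked can be packed, and
  blocking carries over to every shorter history.\<close>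

lemma run_eq_empty:
  assumes "distinct ys" "length ys \<le> b"
    "\<And>w. w \<in> set ys \<Longrightarrow> W < 3 * s w \<Longrightarrow> blocked a W s v ys w"
  shows "run a b W s v ys = {}"
  using assms
proof (induction ys)
  case (Cons x ys)
  \<comment> \<open>While the sample is still being filled, every large item seen lies in it and
    blocks itself.\<close>
  have "blocked a W s v ys w" if "w \<in> set ys" "W < 3 * s w" for w
    using that Cons.prems(3)[of w] blocked_short[of ys a w W s v] blocked_Cons[of a ys W s v x w]
    by (cases "length ys < a") auto
  then have "run a b W s v ys = {}" using Cons by simp
  moreover have "\<not> accepts a b W s v {} ys x"
    using Cons.prems by (intro not_accepts_blocked) auto
  ultimately show ?case by simp
qed simp

text \<open>All large items other than \<open>y\<close> are blocked. \<open>y\<close> arrives after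
  the sample, finds the knapsack empty and beats every sampled large item.\<close>

lemma run_eq_singleton:
  assumes "distinct ys" "length ys \<le> b" "y \<in> set ys" "y \<notin> set (drop (length ys - a) ys)"
    "W < 3 * s y" "s y \<le> W"
    "\<And>z. z \<in> set ys \<Longrightarrow> W < 3 * s z \<Longrightarrow> z \<noteq> y \<Longrightarrow> beats v y z"
    "\<And>w. w \<in> set ys \<Longrightarrow> W < 3 * s w \<Longrightarrow> w \<noteq> y \<Longrightarrow> blocked a W s v ys w"
  shows "run a b W s v ys = {y}"
  using assms
proof (induction ys)
  case (Cons x ys)
  have len: "a \<le> length ys"
  proof (rule ccontr)
    assume "\<not> a \<le> length ys"
    then show False using Cons.prems(3,4) by simp
  qed
  have bl: "blocked a W s v ys w" if "w \<in> set ys" "W < 3 * s w" "w \<noteq> y" for w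
    using that Cons.prems(8)[of w] len by (simp add: blocked_Cons)
  show ?case
  proof (cases "x = y")
    case True
    then have "run a b W s v ys = {}"
      using Cons.prems bl by (intro run_eq_empty) auto
    moreover have "accepts a b W s v {} ys y"
      using Cons.prems len True by (auto simp: accepts_def dest: in_set_dropD)
    ultimately show ?thesis using True by simp
  next
    case False
    then have "run a b W s v ys = {y}"
      using Cons len bl by (intro Cons.IH) (auto simp: Suc_diff_le)
    moreover have "\<not> accepts a b W s v {y} ys x"
      using Cons.prems False by (intro not_accepts_blocked) auto
    ultimately show ?thesis by simp
  qed
qed simp

text \<open>It suffices that the best large item of \<open>Y\<close> is in the sample, as it blocks
  itself and all others; without large items the event is certain.\<close>

lemma perm_avg_all_blocked:
  assumes "finite Y" "Y \<noteq> {}" "a \<le> card Y"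
  shows "real a / card Y \<le>
    perm_avg Y (\<lambda>ys. of_bool (\<forall>w\<in>Y. W < 3 * s w \<longrightarrow> blocked a W s v ys w))"
proof (cases "{w\<in>Y. W < 3 * s w} = {}")
  case True
  then have "perm_avg Y (\<lambda>ys. of_bool (\<forall>w\<in>Y. W < 3 * s w \<longrightarrow> blocked a W s v ys w)) =
     perm_avg Y (\<lambda>ys. 1)"
    by (intro perm_avg_cong) auto
  then show ?thesis using assms by (simp add: perm_avg_const card_gt_0_iff)
next
  case False
  obtain z where z: "z \<in> {w\<in>Y. W < 3 * s w}"
    "\<And>w. w \<in> {w\<in>Y. W < 3 * s w} \<Longrightarrow> w \<noteq> z \<Longrightarrow> beats v z w"
    using exists_best[OF _ False, of v] assms by auto
  have "real a / card Y = perm_avg Y (\<lambda>ys. of_bool (z \<in> set (drop (card Y - a) ys)))"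
    using assms z by (simp add: perm_avg_sample_mem)
  also have "\<dots> \<le> perm_avg Y (\<lambda>ys. of_bool (\<forall>w\<in>Y. W < 3 * s w \<longrightarrow> blocked a W s v ys w))"
  proof (rule perm_avg_mono)
    fix ys :: "'a list" assume "distinct ys" "set ys = Y"
    then have "length ys = card Y" by (metis distinct_card)
    then show "of_bool (z \<in> set (drop (card Y - a) ys)) \<le>
      (of_bool (\<forall>w\<in>Y. W < 3 * s w \<longrightarrow> blocked a W s v ys w) :: real)"
      using z by (auto simp: blocked_def of_bool_def)
  qed
  finally show ?thesis .
qed

text \<open>It suffices that \<open>y\<close> is outside the sample and the best large item other
  than \<open>y\<close> is in it.\<close>

lemma perm_avg_others_blocked:
  assumes "finite Y" "y \<in> Y" "2 \<le> card Y" "a \<le> card Y"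
  shows "(real (card Y) - a) * a / (real (card Y) * (real (card Y) - 1)) \<le>
    perm_avg Y (\<lambda>ys. of_bool (y \<notin> set (drop (card Y - a) ys) \<and>
      (\<forall>w\<in>Y. W < 3 * s w \<longrightarrow> w \<noteq> y \<longrightarrow> blocked a W s v ys w)))"
proof -
  \<comment> \<open>If there is no large item other than \<open>y\<close>, any other element serves
    as \<open>z\<close>; one exists since \<open>2 \<le> card Y\<close>.\<close>
  have "\<exists>z\<in>Y - {y}. \<forall>w\<in>Y. W < 3 * s w \<longrightarrow> w \<noteq> y \<longrightarrow> W < 3 * s z \<and> (w = z \<or> beats v z w)"
  proof (cases "{w\<in>Y - {y}. W < 3 * s w} = {}")
    case True
    have "Y \<noteq> {y}" using assms by auto
    then show ?thesis using True assms by auto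
  next
    case False
    then obtain z where "z \<in> {w\<in>Y - {y}. W < 3 * s w}"
      "\<And>w. w \<in> {w\<in>Y - {y}. W < 3 * s w} \<Longrightarrow> w \<noteq> z \<Longrightarrow> beats v z w"
      using exists_best[OF _ False, of v] assms by auto
    then show ?thesis by auto
  qed
  then obtain z where z: "z \<in> Y" "z \<noteq> y"
    "\<And>w. w \<in> Y \<Longrightarrow> W < 3 * s w \<Longrightarrow> w \<noteq> y \<Longrightarrow> W < 3 * s z \<and> (w = z \<or> beats v z w)"
    by auto
  have "(real (card Y) - a) * a / (real (card Y) * (real (card Y) - 1)) =
    perm_avg Y (\<lambda>ys. of_bool (y \<notin> set (drop (card Y - a) ys) \<and> z \<in> set (drop (card Y - a) ys)))"
    using assms z by (subst perm_avg_sample_mem_nmem) auto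
  also have "\<dots> \<le> perm_avg Y (\<lambda>ys. of_bool (y \<notin> set (drop (card Y - a) ys) \<and>
      (\<forall>w\<in>Y. W < 3 * s w \<longrightarrow> w \<noteq> y \<longrightarrow> blocked a W s v ys w)))"
  proof (rule perm_avg_mono)
    fix ys :: "'a list" assume "distinct ys" "set ys = Y"
    then have "length ys = card Y" by (metis distinct_card)
    then show "of_bool (y \<notin> set (drop (card Y - a) ys) \<and> z \<in> set (drop (card Y - a) ys)) \<le>
      (of_bool (y \<notin> set (drop (card Y - a) ys) \<and>
      (\<forall>w\<in>Y. W < 3 * s w \<longrightarrow> w \<noteq> y \<longrightarrow> blocked a W s v ys w)) :: real)"
      using z(3) by (fastforce simp: blocked_def of_bool_def)
  qed
  finally show ?thesis .
qed

section \<open>Acceptance probabilities of the two best large items\<close>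

locale knapsack_items =
  fixes a b :: nat and W :: real and s v :: "'a::linorder \<Rightarrow> real" and X :: "'a set"
  assumes finite_X: "finite X" and W_pos: "0 < W"
    and s_pos: "\<And>i. i \<in> X \<Longrightarrow> 0 < s i" and s_le: "\<And>i. i \<in> X \<Longrightarrow> s i \<le> W"
    and v_nonneg: "\<And>i. i \<in> X \<Longrightarrow> 0 \<le> v i"
    and a_ge: "2 \<le> a" and a_less: "a < b" and b_le: "b \<le> card X"
begin

abbreviation "pack \<equiv> run a b W s v"
abbreviation "acc \<equiv> accepts a b W s v"
abbreviation "big x \<equiv> W < 3 * s x"

lemma accept_first:
  assumes "distinct (x # ys)" "set (x # ys) \<subseteq> X" "a \<le> length ys" "length ys < b"
    "big x" "\<And>w. w \<in> set ys \<Longrightarrow> big w \<Longrightarrow> beats v x w"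
    "\<And>w. w \<in> set ys \<Longrightarrow> big w \<Longrightarrow> blocked a W s v ys w"
  shows "acc (pack ys) ys x" "pack ys = {}"
proof -
  show "pack ys = {}" using assms by (intro run_eq_empty) auto
  then show "acc (pack ys) ys x"
    using assms s_le[of x] by (auto simp: accepts_def dest: in_set_dropD)
qed

text \<open>\<open>x\<close> arrives last among \<open>S\<close>. It is packed if the best of the
  earlier large items was sampled, since then nothing has been packed before. Keeping
  \<open>pack ys = {}\<close> in the event makes it disjoint from the one in
  \<open>prob_accept_second\<close>.\<close>

lemma prob_accept_first:
  assumes "S \<subseteq> X" "a < card S" "card S \<le> b" "x \<in> S" "big x"
    "\<And>w. w \<in> S \<Longrightarrow> big w \<Longrightarrow> w \<noteq> x \<Longrightarrow> beats v x w"
  shows "real a / (real (card S) - 1) \<le> perm_avg (S - {x}) (\<lambda>ys. of_bool (acc (pack ys) ys x \<and> pack ys = {}))"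
proof -
  have fin: "finite S" using assms finite_X finite_subset by blast
  have c: "card (S - {x}) = card S - 1" using assms fin by simp
  have "real a / card (S - {x}) \<le>
    perm_avg (S - {x}) (\<lambda>ys. of_bool (\<forall>w\<in>S - {x}. big w \<longrightarrow> blocked a W s v ys w))"
  proof (rule perm_avg_all_blocked)
    have "0 < card (S - {x})" using c assms a_ge by simp
    then show "S - {x} \<noteq> {}" by (metis card.empty less_irrefl)
  qed (use c assms fin in auto)
  also have "\<dots> \<le> perm_avg (S - {x}) (\<lambda>ys. of_bool (acc (pack ys) ys x \<and> pack ys = {}))"
  proof (rule perm_avg_mono)
    fix ys :: "'a list" assume ys: "distinct ys" "set ys = S - {x}"
    then have "length ys = card S - 1" using c by (metis distinct_card)
    then have "acc (pack ys) ys x \<and> pack ys = {}" if "\<forall>w\<in>S - {x}. big w \<longrightarrow> blocked a W s v ys w"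
      using that ys assms a_less by (intro conjI accept_first[of x ys]) auto
    then show "of_bool (\<forall>w\<in>S - {x}. big w \<longrightarrow> blocked a W s v ys w) \<le>
      (of_bool (acc (pack ys) ys x \<and> pack ys = {}) :: real)" by (auto simp: of_bool_def)
  qed
  finally show ?thesis using c assms by (simp add: of_nat_diff)
qed

lemma accept_second:
  assumes "distinct (x # ys)" "set (x # ys) \<subseteq> X" "a \<le> length ys" "length ys < b"
    "big x" "big y" "y \<in> set ys" "s x + s y \<le> W" "y \<notin> set (drop (length ys - a) ys)"
    "\<And>w. w \<in> set ys \<Longrightarrow> big w \<Longrightarrow> w \<noteq> y \<Longrightarrow> beats v x w \<and> beats v y w"
    "\<And>w. w \<in> set ys \<Longrightarrow> big w \<Longrightarrow> w \<noteq> y \<Longrightarrow> blocked a W s v ys w"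
  shows "acc (pack ys) ys x" "pack ys = {y}"
proof -
  show "pack ys = {y}" using assms s_le[of y] by (intro run_eq_singleton) auto
  then show "acc (pack ys) ys x"
    using assms(1-9) assms(10) by (auto simp: accepts_def add.commute dest: in_set_dropD)
qed

text \<open>If \<open>y\<close> is not sampled and all other earlier large items are blocked, the
  knapsack holds exactly \<open>y\<close> when \<open>x\<close> arrives. No order between
  \<open>x\<close> and \<open>y\<close> is assumed, so the lemma applies in both directions.\<close>

lemma prob_accept_second:
  assumes "S \<subseteq> X" "a < card S" "card S \<le> b" "x \<in> S" "y \<in> S" "x \<noteq> y" "big x" "big y" "s x + s y \<le> W"
    "\<And>w. w \<in> S \<Longrightarrow> big w \<Longrightarrow> w \<noteq> x \<Longrightarrow> w \<noteq> y \<Longrightarrow> beats v x w \<and> beats v y w"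
  shows "(real (card S) - 1 - a) * a / ((real (card S) - 1) * (real (card S) - 2)) \<le>
     perm_avg (S - {x}) (\<lambda>ys. of_bool (acc (pack ys) ys x \<and> pack ys = {y}))"
proof -
  have fin: "finite S" using assms finite_X finite_subset by blast
  have c: "card (S - {x}) = card S - 1" using assms fin by simp
  have c': "real (card (S - {x})) = real (card S) - 1" using c assms by (simp add: of_nat_diff)
  have "(real (card (S - {x})) - a) * a / (real (card (S - {x})) * (real (card (S - {x})) - 1)) \<le>
    perm_avg (S - {x}) (\<lambda>ys. of_bool (y \<notin> set (drop (card (S - {x}) - a) ys) \<and>
      (\<forall>w\<in>S - {x}. big w \<longrightarrow> w \<noteq> y \<longrightarrow> blocked a W s v ys w)))"
    using assms fin c a_ge by (intro perm_avg_others_blocked) auto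
  also have "\<dots> \<le> perm_avg (S - {x}) (\<lambda>ys. of_bool (acc (pack ys) ys x \<and> pack ys = {y}))"
  proof (rule perm_avg_mono)
    fix ys :: "'a list" assume ys: "distinct ys" "set ys = S - {x}"
    then have len: "length ys = card (S - {x})" by (metis distinct_card)
    have "acc (pack ys) ys x \<and> pack ys = {y}"
      if "y \<notin> set (drop (card (S - {x}) - a) ys)" "\<forall>w\<in>S - {x}. big w \<longrightarrow> w \<noteq> y \<longrightarrow> blocked a W s v ys w"
      using that ys assms len c by (intro conjI accept_second[of x ys y]) auto
    then show "of_bool (y \<notin> set (drop (card (S - {x}) - a) ys) \<and>
      (\<forall>w\<in>S - {x}. big w \<longrightarrow> w \<noteq> y \<longrightarrow> blocked a W s v ys w)) \<le>
      (of_bool (acc (pack ys) ys x \<and> pack ys = {y}) :: real)" by (auto simp: of_bool_def)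
  qed
  finally show ?thesis unfolding c' by (simp add: algebra_simps)
qed

text \<open>An empty knapsack and a knapsack holding \<open>{y}\<close> are disjoint events, so the
  two acceptance probabilities of \<open>x\<close> add up.\<close>

lemma prob_accept_first_or_second:
  assumes "S \<subseteq> X" "a < card S" "card S \<le> b" "x \<in> S" "y \<in> S" "big x" "big y" "s x + s y \<le> W"
    "beats v x y" "\<And>w. w \<in> S \<Longrightarrow> big w \<Longrightarrow> w \<noteq> x \<Longrightarrow> w \<noteq> y \<Longrightarrow> beats v y w"
  shows "real a / (real (card S) - 1) +
     (real (card S) - 1 - a) * a / ((real (card S) - 1) * (real (card S) - 2)) \<le>
     perm_avg (S - {x}) (\<lambda>ys. of_bool (acc (pack ys) ys x))"
proof -
  have best: "beats v x w" if "w \<in> S" "big w" "w \<noteq> x" for w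
    using that assms(9) assms(10)[of w] beats_trans[of v x y w] by (cases "w = y") auto
  have "real a / (real (card S) - 1) \<le> perm_avg (S - {x}) (\<lambda>ys. of_bool (acc (pack ys) ys x \<and> pack ys = {}))"
    using assms best by (intro prob_accept_first) auto
  moreover have "(real (card S) - 1 - a) * a / ((real (card S) - 1) * (real (card S) - 2)) \<le>
     perm_avg (S - {x}) (\<lambda>ys. of_bool (acc (pack ys) ys x \<and> pack ys = {y}))"
  proof (rule prob_accept_second)
    show "x \<noteq> y" using assms(9) by (auto simp: beats_def)
  qed (use assms beats_trans in metis)+
  ultimately have "real a / (real (card S) - 1) +
     (real (card S) - 1 - a) * a / ((real (card S) - 1) * (real (card S) - 2)) \<le>
     perm_avg (S - {x}) (\<lambda>ys. of_bool (acc (pack ys) ys x \<and> pack ys = {}) +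
       of_bool (acc (pack ys) ys x \<and> pack ys = {y}))"
    unfolding perm_avg_add by linarith
  also have "\<dots> \<le> perm_avg (S - {x}) (\<lambda>ys. of_bool (acc (pack ys) ys x))"
    by (rule perm_avg_mono) (auto simp: of_bool_def)
  finally show ?thesis .
qed

lemma gain_nonneg: "set ys \<subseteq> X \<Longrightarrow> 0 \<le> gain a b W s v ys"
  by (cases ys) (auto simp: v_nonneg)

lemma perm_avg_gain_ge:
  assumes "S \<subseteq> X" "T \<subseteq> S" "T \<noteq> {}"
  shows "(\<Sum>x\<in>T. v x * perm_avg (S - {x}) (\<lambda>ys. of_bool (acc (pack ys) ys x))) / card S
    \<le> perm_avg S (gain a b W s v)"
proof -
  have "finite S" "S \<noteq> {}" using assms finite_X finite_subset by blast+
  then show ?thesis using assms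
    by (auto simp: perm_avg_gain intro!: divide_right_mono sum_mono2 mult_nonneg_nonneg v_nonneg perm_avg_nonneg)
qed

lemma gain_best:
  assumes "S \<subseteq> X" "a < card S" "card S \<le> b" "x \<in> S" "big x"
    "\<And>w. w \<in> S \<Longrightarrow> big w \<Longrightarrow> w \<noteq> x \<Longrightarrow> beats v x w"
  shows "v x * (real a / (real (card S) - 1)) / card S \<le> perm_avg S (gain a b W s v)"
proof -
  have "real a / (real (card S) - 1) \<le> perm_avg (S - {x}) (\<lambda>ys. of_bool (acc (pack ys) ys x \<and> pack ys = {}))"
    using assms by (intro prob_accept_first) auto
  also have "\<dots> \<le> perm_avg (S - {x}) (\<lambda>ys. of_bool (acc (pack ys) ys x))"
    by (rule perm_avg_mono) auto
  finally have "v x * (real a / (real (card S) - 1)) / card S \<le>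
    (\<Sum>x\<in>{x}. v x * perm_avg (S - {x}) (\<lambda>ys. of_bool (acc (pack ys) ys x))) / card S"
    using assms v_nonneg[of x] by (simp del: times_divide_eq_right) (intro divide_right_mono mult_left_mono, auto)
  also have "\<dots> \<le> perm_avg S (gain a b W s v)"
    using assms by (intro perm_avg_gain_ge) auto
  finally show ?thesis .
qed

text \<open>The better item \<open>x\<close> counts both as the first and as the second item packed;
  \<open>y\<close> is counted only if it arrives after \<open>x\<close> has been packed.\<close>

lemma gain_best_pair:
  assumes "S \<subseteq> X" "a < card S" "card S \<le> b" "x \<in> S" "y \<in> S" "big x" "big y" "s x + s y \<le> W"
    "beats v x y" "\<And>w. w \<in> S \<Longrightarrow> big w \<Longrightarrow> w \<noteq> x \<Longrightarrow> w \<noteq> y \<Longrightarrow> beats v y w"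
  shows "(v x * (real a / (real (card S) - 1)) + (v x + v y) *
      ((real (card S) - 1 - a) * a / ((real (card S) - 1) * (real (card S) - 2)))) / card S
     \<le> perm_avg S (gain a b W s v)"
proof -
  let ?q = "(real (card S) - 1 - a) * a / ((real (card S) - 1) * (real (card S) - 2))"
  let ?p = "\<lambda>x. perm_avg (S - {x}) (\<lambda>ys. of_bool (acc (pack ys) ys x))"
  have xy: "x \<noteq> y" using assms(9) by (auto simp: beats_def)
  have x: "real a / (real (card S) - 1) + ?q \<le> ?p x"
    using assms by (intro prob_accept_first_or_second) auto
  have "?q \<le> perm_avg (S - {y}) (\<lambda>ys. of_bool (acc (pack ys) ys y \<and> pack ys = {x}))"
    by (rule prob_accept_second) (use assms xy beats_trans in \<open>metis add.commute\<close>)+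
  also have "\<dots> \<le> ?p y" by (rule perm_avg_mono) auto
  finally have y: "?q \<le> ?p y" .
  have "v x * (real a / (real (card S) - 1)) + (v x + v y) * ?q =
      v x * (real a / (real (card S) - 1) + ?q) + v y * ?q"
    by (simp only: distrib_left distrib_right add.assoc)
  also have "\<dots> \<le> v x * ?p x + v y * ?p y"
    using x y assms v_nonneg by (intro add_mono mult_left_mono) auto
  also have "\<dots> = (\<Sum>x\<in>{x, y}. v x * ?p x)" using xy by simp
  finally have "(v x * (real a / (real (card S) - 1)) + (v x + v y) * ?q) / card S
     \<le> (\<Sum>x\<in>{x, y}. v x * ?p x) / card S" by (rule divide_right_mono) simp
  also have "\<dots> \<le> perm_avg S (gain a b W s v)"
    using assms by (intro perm_avg_gain_ge) auto
  finally show ?thesis .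
qed

end

text \<open>Both sides are linear in \<open>(x, y)\<close>, and the cone
  \<open>0 \<le> y \<le> x\<close> is spanned by \<open>(1, 0)\<close> and \<open>(1, 1)\<close>.
  The first two assumptions are the inequality at these points.\<close>

lemma two_weights:
  fixes p q \<alpha> x y :: real
  assumes "\<alpha> \<le> p" "2 * \<alpha> \<le> p + q" "0 \<le> y" "y \<le> x"
  shows "\<alpha> * (x + y) \<le> x * p + y * q"
proof -
  have "\<alpha> * (x + y) = \<alpha> * (x - y) + (2 * \<alpha>) * y" by (simp add: algebra_simps)
  also have "\<dots> \<le> p * (x - y) + (p + q) * y"
    using assms by (intro add_mono mult_right_mono) auto
  finally show ?thesis by (simp add: algebra_simps)
qed

subsection \<open>Expected gain per round\<close>

text \<open>The small items that the third phase would pack if there were no capacity constraint.\<close>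

primrec tentative ::
  "nat \<Rightarrow> real \<Rightarrow> ('a \<Rightarrow> real) \<Rightarrow> ('a \<Rightarrow> real) \<Rightarrow> 'a list \<Rightarrow> 'a set" where
  "tentative b W s v [] = {}"
| "tentative b W s v (x # ys) =
     (if b \<le> length ys \<and> x \<in> opt_packing W s v {i \<in> set (x # ys). 3 * s i \<le> W}
      then insert x (tentative b W s v ys) else tentative b W s v ys)"

lemma tentative_subset: "tentative b W s v ys \<subseteq> set ys"
  by (induction ys) auto

lemma finite_tentative [simp]: "finite (tentative b W s v ys)"
  by (rule finite_subset[OF tentative_subset]) simp

lemma tentative_short: "length ys \<le> b \<Longrightarrow> tentative b W s v ys = {}"
  by (induction ys) auto

text \<open>A tentative decision depends on the set and the number of items seen, and none is
  positive in the first \<open>b\<close> rounds; so of these rounds only the set of arrivals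
  matters.\<close>

lemma tentative_append_cong:
  assumes "set zs = set zs'" "length zs = b" "length zs' = b"
  shows "tentative b W s v (ys @ zs) = tentative b W s v (ys @ zs')"
  by (induction ys) (use assms in \<open>simp_all add: tentative_short\<close>)

text \<open>With nothing packed in the first \<open>b\<close> rounds, whatever is added later is
  small and passes the test of \<open>tentative\<close>; the capacity can only rule out further
  items.\<close>

lemma run_subset_tentative:
  assumes "b \<le> length ys" "run a b W s v (drop (length ys - b) ys) = {}"
  shows "run a b W s v ys \<subseteq> tentative b W s v ys \<inter> {i. 3 * s i \<le> W}"
  using assms
proof (induction ys)
  case (Cons x ys)
  show ?case
  proof (cases "b \<le> length ys")
    case True
    then have "run a b W s v ys \<subseteq> tentative b W s v ys \<inter> {i. 3 * s i \<le> W}"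
      using Cons by (simp add: Suc_diff_le)
    then show ?thesis using True by (auto simp: accepts_def split: if_splits)
  next
    case False
    then show ?thesis using Cons.prems by simp
  qed
qed simp

context knapsack_items
begin

abbreviation "n \<equiv> card X"
abbreviation "round_gain l \<equiv> subset_avg X l (\<lambda>S. perm_avg S (gain a b W s v))"

text \<open>Linearity over rounds, then \<open>perm_avg_drop\<close>: the items seen up to round
  \<open>Suc m\<close> form a random subset, and their order is random as well.\<close>

lemma perm_avg_run_eq:
  "perm_avg X (\<lambda>ys. sum v (pack ys)) = (\<Sum>m<n. round_gain (Suc m))"
proof -
  have "perm_avg X (\<lambda>ys. sum v (pack ys)) = perm_avg X (\<lambda>ys. \<Sum>k<n. gain a b W s v (drop k ys))"
    by (rule perm_avg_cong) (metis sum_run_eq_gain distinct_card)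
  also have "\<dots> = (\<Sum>k<n. perm_avg X (\<lambda>ys. gain a b W s v (drop k ys)))"
    by (rule perm_avg_sum)
  also have "\<dots> = (\<Sum>m<n. perm_avg X (\<lambda>ys. gain a b W s v (drop (n - Suc m) ys)))"
    by (rule sum.nat_diff_reindex[symmetric])
  also have "\<dots> = (\<Sum>m<n. round_gain (Suc m))"
    by (intro sum.cong refl perm_avg_drop) (use finite_X in auto)
  finally show ?thesis .
qed

lemma round_gain_nonneg: "0 \<le> round_gain l"
proof -
  have "subset_avg X l (\<lambda>_. 0) \<le> round_gain l"
    by (intro subset_avg_mono perm_avg_nonneg gain_nonneg) auto
  then show ?thesis by (simp add: subset_avg_def)
qed

lemma subset_avg_miss:
  assumes "x \<in> X" "l \<le> n"
  shows "subset_avg X l (\<lambda>S. of_bool (S \<inter> {x} = {})) = (real n - l) / n"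
proof -
  have "n \<ge> 1" using assms finite_X card_gt_0_iff by (metis One_nat_def Suc_leI empty_iff)
  then show ?thesis using assms finite_X subset_avg_disjoint[of X "{x}" l] binomial_quotient_1[of l n]
    by simp
qed

lemma subset_avg_miss2:
  assumes "x \<in> X" "y \<in> X" "x \<noteq> y" "l \<le> n"
  shows "subset_avg X l (\<lambda>S. of_bool (S \<inter> {x, y} = {})) =
    (real n - l) * (real n - l - 1) / (real n * (real n - 1))"
proof -
  have "n \<ge> 2" using a_ge a_less b_le by simp
  then show ?thesis using assms finite_X subset_avg_disjoint[of X "{x, y}" l] binomial_quotient_2[of l n]
    by (simp add: numeral_2_eq_2)
qed

lemma subset_avg_miss3:
  assumes "x \<in> X" "y \<in> X" "z \<in> X" "x \<noteq> y" "x \<noteq> z" "y \<noteq> z" "l \<le> n"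
  shows "subset_avg X l (\<lambda>S. of_bool (S \<inter> {x, y, z} = {})) \<le> ((real n - l) / n) ^ 3"
proof -
  have "n \<ge> 3" using a_ge a_less b_le by simp
  then show ?thesis using assms finite_X subset_avg_disjoint[of X "{x, y, z}" l] binomial_quotient_3[of l n]
    by (simp add: numeral_3_eq_3)
qed

lemma perm_gain_nonneg: "S \<subseteq> X \<Longrightarrow> 0 \<le> perm_avg S (gain a b W s v)"
  by (intro perm_avg_nonneg gain_nonneg) auto

text \<open>\<open>x\<close> is among the first \<open>Suc m\<close> arrivals with probability
  \<open>Suc m / n\<close>, and is then the best large one there; the factor
  \<open>1 / Suc m\<close> for arriving last cancels.\<close>

lemma round_gain_best:
  assumes "a \<le> m" "m < b" "x \<in> X" "big x"
    "\<And>w. w \<in> X \<Longrightarrow> big w \<Longrightarrow> w \<noteq> x \<Longrightarrow> beats v x w"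
  shows "v x * (a / (real m * n)) \<le> round_gain (Suc m)"
proof -
  have mn: "Suc m \<le> n" "m > 0" "n > 0" using assms b_le a_ge by auto
  let ?c = "v x * (real a / m) / real (Suc m)"
  have "v x * (a / (real m * n)) = ?c * (1 - (real n - Suc m) / n)"
    using mn by (simp add: field_simps del: of_nat_Suc)
  also have "\<dots> = subset_avg X (Suc m) (\<lambda>S. ?c * (1 - of_bool (S \<inter> {x} = {})))"
    using mn assms finite_X
    by (simp only: subset_avg_mult subset_avg_diff subset_avg_const subset_avg_miss)
  also have "\<dots> \<le> round_gain (Suc m)"
  proof (rule subset_avg_mono)
    fix S assume S: "S \<subseteq> X" "card S = Suc m"
    show "?c * (1 - of_bool (S \<inter> {x} = {})) \<le> perm_avg S (gain a b W s v)"
    proof (cases "x \<in> S")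
      case True
      then show ?thesis using gain_best[of S x] S assms by auto
    qed (use S perm_gain_nonneg in auto)
  qed
  finally show ?thesis .
qed

text \<open>If \<open>x\<close> has not arrived but \<open>y\<close> or \<open>z\<close> has, the
  best large item seen is worth at least \<open>v z\<close>. This has probability \<open>u\<close>
  minus that of missing all three, hence at least \<open>u - u ^ 3\<close>.\<close>

lemma round_gain_best3:
  assumes "a \<le> m" "m < b" "x \<in> X" "y \<in> X" "z \<in> X" "x \<noteq> y" "x \<noteq> z" "y \<noteq> z" "big x" "big y" "big z"
    "\<And>w. w \<in> X \<Longrightarrow> big w \<Longrightarrow> w \<noteq> x \<Longrightarrow> beats v x w" "v z \<le> v y"
  defines "u \<equiv> (real n - Suc m) / n"
  shows "v x * (a / (real m * n)) + v z * (a / (real m * n) * (u + u\<^sup>2)) \<le> round_gain (Suc m)"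
proof -
  have mn: "Suc m \<le> n" "m > 0" "n > 0" using assms b_le a_ge by auto
  define r where "r = (real a / m) / real (Suc m)"
  have r: "r \<ge> 0" by (simp add: r_def)
  let ?d = "\<lambda>Z S. of_bool (S \<inter> Z = {}) :: real"
  have ru: "a / (real m * n) = r * (1 - u)"
    using mn by (simp add: field_simps r_def u_def del: of_nat_Suc)
  have d3: "subset_avg X (Suc m) (?d {x, y, z}) \<le> u ^ 3"
    using assms mn by (subst u_def, intro subset_avg_miss3) auto
  \<comment> \<open>Uses \<open>(1 - u) * (u + u ^ 2) = u - u ^ 3\<close>.\<close>
  have "v x * (a / (real m * n)) + v z * (a / (real m * n) * (u + u\<^sup>2)) =
     r * (v x * (1 - u) + v z * (u - u ^ 3))"
    unfolding ru by (simp add: algebra_simps power2_eq_square power3_eq_cube)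
  also have "\<dots> \<le> r * (v x * (1 - u) + v z * (u - subset_avg X (Suc m) (?d {x, y, z})))"
    using d3 v_nonneg assms r by (intro mult_left_mono add_mono) auto
  also have "\<dots> = subset_avg X (Suc m) (\<lambda>S. r * (v x * (1 - ?d {x} S) + v z * (?d {x} S - ?d {x, y, z} S)))"
    using mn assms(1-13) finite_X
    by (simp only: subset_avg_mult subset_avg_diff subset_avg_add subset_avg_const subset_avg_miss u_def)
  also have "\<dots> \<le> round_gain (Suc m)"
  proof (rule subset_avg_mono)
    fix S assume S: "S \<subseteq> X" "card S = Suc m"
    consider "x \<in> S" | "x \<notin> S" "S \<inter> {y, z} \<noteq> {}" | "S \<inter> {x, y, z} = {}" by auto
    then show "r * (v x * (1 - ?d {x} S) + v z * (?d {x} S - ?d {x, y, z} S)) \<le> perm_avg S (gain a b W s v)"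
    proof cases
      case 1
      then show ?thesis using gain_best[of S x] S assms by (auto simp: r_def mult.commute)
    next
      case 2
      let ?B = "{w\<in>S. big w}"
      have "?B \<noteq> {}" "finite ?B" using 2 assms finite_subset[OF S(1) finite_X] by auto
      then obtain t where t: "t \<in> ?B" "\<And>w. w \<in> ?B \<Longrightarrow> w \<noteq> t \<Longrightarrow> beats v t w"
        using exists_best by blast
      have "v y \<le> v t" if "y \<in> S" using that t(2)[of y] assms beats_imp_ge[of v t y] by (cases "y = t") auto
      moreover have "v z \<le> v t" if "z \<in> S" using that t(2)[of z] assms beats_imp_ge[of v t z] by (cases "z = t") auto
      ultimately have "v z \<le> v t" using 2 assms(13) by auto
      have "?d {x} S = 1" "?d {x, y, z} S = 0" using 2 by auto
      then have "r * (v x * (1 - ?d {x} S) + v z * (?d {x} S - ?d {x, y, z} S)) = r * v z"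
        by simp
      also have "\<dots> \<le> r * v t" using \<open>v z \<le> v t\<close> r by (rule mult_left_mono)
      also have "\<dots> = v t * (real a / (real (card S) - 1)) / card S"
        using S by (simp add: r_def)
      also have "\<dots> \<le> perm_avg S (gain a b W s v)"
        using t S assms by (intro gain_best) auto
      finally show ?thesis .
    next
      case 3
      then show ?thesis using S perm_gain_nonneg by auto
    qed
  qed
  finally show ?thesis .
qed

text \<open>The cases are which of \<open>x\<close> and \<open>y\<close> have arrived. With both
  present, \<open>gain_best_pair\<close> applies; with one, that one is the best large item
  seen.\<close>

lemma round_gain_best_pair:
  assumes "a \<le> m" "m < b" "x \<in> X" "y \<in> X" "big x" "big y" "s x + s y \<le> W" "beats v x y"
    "\<And>w. w \<in> X \<Longrightarrow> big w \<Longrightarrow> w \<noteq> x \<Longrightarrow> w \<noteq> y \<Longrightarrow> beats v y w"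
  defines "q \<equiv> a * (real m - a) / (real m * (real n)\<^sup>2)"
  shows "v x * (a / (real m * n) + q) + v y * (a * (real n - 1 - m) / (real m * (real n)\<^sup>2) + q) \<le> round_gain (Suc m)"
proof -
  have mn: "Suc m \<le> n" "m > 1" "n > 1" using assms b_le a_ge by auto
  have xy: "x \<noteq> y" using assms(8) by (auto simp: beats_def)
  have best: "beats v x w" if "w \<in> X" "big w" "w \<noteq> x" for w
    using that assms(8) assms(9)[of w] beats_trans[of v x y w] by (cases "w = y") auto
  define r where "r = (real a / m) / real (Suc m)"
  define q' where "q' = ((real m - a) * a / (real m * (real m - 1))) / real (Suc m)"
  have r: "r \<ge> 0" by (simp add: r_def)
  let ?d = "\<lambda>Z S. of_bool (S \<inter> Z = {}) :: real"
  \<comment> \<open>\<open>f\<close> bounds the gain given \<open>S\<close> from below; the factor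
    of \<open>v x + v y\<close> indicates by inclusion and exclusion that both items are in
    \<open>S\<close>.\<close>
  define f where "f S = r * (v x * (1 - ?d {x} S) + v y * (?d {x} S - ?d {x, y} S)) +
     q' * ((v x + v y) * (1 - ?d {x} S - ?d {y} S + ?d {x, y} S))" for S
  define D1 where "D1 = (real n - Suc m) / n"
  define D2 where "D2 = (real n - Suc m) * (real n - Suc m - 1) / (real n * (real n - 1))"
  have f: "subset_avg X (Suc m) f = r * (v x * (1 - D1) + v y * (D1 - D2)) +
     q' * ((v x + v y) * (1 - D1 - D1 + D2))"
    unfolding f_def D1_def D2_def using mn assms(1-8) finite_X xy
    by (simp only: subset_avg_mult subset_avg_diff subset_avg_add subset_avg_const
        subset_avg_miss subset_avg_miss2[OF assms(3,4) xy])
  have nn: "real n * (real n - 1) \<le> (real n)\<^sup>2" "0 < real n * (real n - 1)"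
    using mn by (auto simp: power2_eq_square)
  have "r * (1 - D1) = a / (real m * n)"
    using mn by (simp add: field_simps r_def D1_def del: of_nat_Suc)
  \<comment> \<open>Here \<open>n * (n - 1)\<close> is weakened to \<open>n ^ 2\<close>, and below
    also \<open>m - 1\<close> to \<open>m\<close>, so that the sums over \<open>m\<close> take the
    form of Riemann sums.\<close>
  moreover have "r * (D1 - D2) \<ge> a * (real n - 1 - m) / (real m * (real n)\<^sup>2)"
  proof -
    have "D1 - D2 = (real n - 1 - m) * real (Suc m) / (real n * (real n - 1))"
      using mn by (simp add: D1_def D2_def divide_simps) (simp add: algebra_simps)
    then have "r * (D1 - D2) = (a * (real n - 1 - m) / m) / (real n * (real n - 1))"
      by (simp add: r_def del: of_nat_Suc)
    also have "\<dots> \<ge> (a * (real n - 1 - m) / m) / (real n)\<^sup>2"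
      using nn mn by (intro divide_left_mono mult_nonneg_nonneg divide_nonneg_nonneg mult_pos_pos) auto
    finally show ?thesis by (simp add: field_simps)
  qed
  moreover have "q' * (1 - D1 - D1 + D2) \<ge> q"
  proof -
    have "1 - D1 - D1 + D2 = m * real (Suc m) / (real n * (real n - 1))"
      using mn by (simp add: D1_def D2_def divide_simps) (simp add: algebra_simps)
    then have "q' * (1 - D1 - D1 + D2) = ((real m - a) * a) / ((real m - 1) * (real n * (real n - 1)))"
      using mn by (simp add: q'_def del: of_nat_Suc)
    also have "\<dots> \<ge> ((real m - a) * a) / (real m * (real n)\<^sup>2)"
      using nn mn assms(1) by (intro divide_left_mono mult_mono mult_nonneg_nonneg mult_pos_pos) auto
    finally show ?thesis by (simp add: q_def mult.commute)
  qed
  ultimately have "v x * (a / (real m * n) + q) + v y * (a * (real n - 1 - m) / (real m * (real n)\<^sup>2) + q) \<le>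
    v x * (r * (1 - D1) + q' * (1 - D1 - D1 + D2)) + v y * (r * (D1 - D2) + q' * (1 - D1 - D1 + D2))"
    using v_nonneg assms(3,4) by (intro add_mono mult_left_mono) auto
  also have "\<dots> = subset_avg X (Suc m) f"
    unfolding f by (simp add: algebra_simps)
  also have "\<dots> \<le> round_gain (Suc m)"
  proof (rule subset_avg_mono)
    fix S assume S: "S \<subseteq> X" "card S = Suc m"
    consider "x \<in> S" "y \<in> S" | "x \<in> S" "y \<notin> S" | "x \<notin> S" "y \<in> S" | "x \<notin> S" "y \<notin> S" by auto
    then show "f S \<le> perm_avg S (gain a b W s v)"
    proof cases
      case 1
      then have "f S = (v x * (real a / (real (card S) - 1)) + (v x + v y) *
        ((real (card S) - 1 - a) * a / ((real (card S) - 1) * (real (card S) - 2)))) / card S"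
        using S by (simp add: f_def r_def q'_def add_divide_distrib mult_ac)
      then show ?thesis using gain_best_pair[of S x y] 1 S assms by auto
    next
      case 2
      then show ?thesis using gain_best[of S x] best S assms by (auto simp: f_def r_def mult.commute)
    next
      case 3
      have "beats v y w" if "w \<in> S" "big w" "w \<noteq> y" for w
        using that 3 S assms(9)[of w] by auto
      then show ?thesis using 3 gain_best[of S y] S assms by (auto simp: f_def r_def mult.commute)
    next
      case 4
      then show ?thesis using S perm_gain_nonneg by (auto simp: f_def)
    qed
  qed
  finally show ?thesis .
qed


abbreviation "tent \<equiv> tentative b W s v"

subsection \<open>Small items\<close>

text \<open>In a round \<open>j > b\<close> the last arrival is uniform among the \<open>j\<close>
  items seen, and the packing depends on their set only. That round therefore adds at most
  \<open>W / j\<close> in expectation.\<close>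

lemma tentative_size:
  assumes "Y \<subseteq> X"
  shows "perm_avg Y (\<lambda>ys. sum s (tent ys)) \<le> W * (\<Sum>j\<in>{b<..card Y}. 1 / j)"
  using assms
proof (induction "card Y" arbitrary: Y)
  case 0
  then have "Y = {}" using finite_X finite_subset by fastforce
  then show ?case by (simp add: perm_avg_def)
next
  case (Suc m)
  have fin: "finite Y" "Y \<noteq> {}" using Suc by (auto intro: finite_subset[OF _ finite_X])
  let ?S = "{i \<in> Y. 3 * s i \<le> W}"
  let ?c = "\<lambda>x. if b \<le> m \<and> x \<in> opt_packing W s v ?S then s x else 0"
  have M: "opt_packing W s v ?S \<subseteq> ?S" "sum s (opt_packing W s v ?S) \<le> W"
    using opt_packing(1,2)[of ?S W s v] fin W_pos by simp_all
  have *: "perm_avg (Y - {x}) (\<lambda>ys. sum s (tent (x # ys))) \<le> W * (\<Sum>j\<in>{b<..m}. 1 / j) + ?c x"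
    if x: "x \<in> Y" for x
  proof -
    have "perm_avg (Y - {x}) (\<lambda>ys. sum s (tent (x # ys))) \<le>
      perm_avg (Y - {x}) (\<lambda>ys. sum s (tent ys) + ?c x)"
    proof (rule perm_avg_mono)
      fix ys assume ys: "distinct ys" "set ys = Y - {x}"
      then have "length ys = m" using Suc.hyps(2) fin x by (metis card_Diff_singleton diff_Suc_1 distinct_card)
      moreover have "set (x # ys) = Y" using ys x by auto
      moreover have "x \<notin> tent ys" using ys tentative_subset[of b W s v ys] by auto
      ultimately show "sum s (tent (x # ys)) \<le> sum s (tent ys) + ?c x" by simp
    qed
    also have "\<dots> = perm_avg (Y - {x}) (\<lambda>ys. sum s (tent ys)) + ?c x"
      using fin by (simp add: perm_avg_add perm_avg_const)
    also have "\<dots> \<le> W * (\<Sum>j\<in>{b<..card (Y - {x})}. 1 / j) + ?c x"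
      using Suc.hyps x fin Suc.prems by (intro add_right_mono Suc.hyps(1)) auto
    also have "card (Y - {x}) = m" using Suc.hyps(2) x fin by simp
    finally show ?thesis .
  qed
  have c: "(\<Sum>x\<in>Y. ?c x) \<le> (if b \<le> m then W else 0)"
  proof (cases "b \<le> m")
    case True
    have "(\<Sum>x\<in>Y. ?c x) = (\<Sum>x\<in>opt_packing W s v ?S. s x)"
      using True M(1) fin by (intro sum.mono_neutral_cong_right) auto
    then show ?thesis using True M(2) by simp
  qed auto
  have "perm_avg Y (\<lambda>ys. sum s (tent ys)) =
      (\<Sum>x\<in>Y. perm_avg (Y - {x}) (\<lambda>ys. sum s (tent (x # ys)))) / card Y"
    using fin by (rule perm_avg_Cons)
  also have "\<dots> \<le> (\<Sum>x\<in>Y. W * (\<Sum>j\<in>{b<..m}. 1 / j) + ?c x) / card Y"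
    using * by (intro divide_right_mono sum_mono) auto
  also have "\<dots> = W * (\<Sum>j\<in>{b<..m}. 1 / j) + (\<Sum>x\<in>Y. ?c x) / card Y"
    using fin by (simp add: sum.distrib add_divide_distrib del: sum.If_cases)
  also have "\<dots> \<le> W * (\<Sum>j\<in>{b<..m}. 1 / j) + (if b \<le> m then W else 0) / card Y"
    using c by (intro add_left_mono divide_right_mono) auto
  also have "\<dots> = W * (\<Sum>j\<in>{b<..card Y}. 1 / j)"
  proof (cases "b \<le> m")
    case True
    then have "{b<..card Y} = insert (card Y) {b<..m}" using Suc.hyps(2) by auto
    then show ?thesis using True Suc.hyps(2)[symmetric] by (simp add: algebra_simps)
  next
    case False
    then have "{b<..card Y} = {}" "{b<..m} = {}" using Suc.hyps(2) by auto
    then show ?thesis using False by simp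
  qed
  finally show ?case .
qed

text \<open>The large-item phase depends only on the order of the first \<open>b\<close> arrivals, and \<open>g\<close> does not
  depend on that order at all.\<close>

lemma no_large_packed_indep:
  assumes "Y \<subseteq> X" "b \<le> card Y" "\<And>ys. 0 \<le> g ys"
    "\<And>ys zs zs'. set zs = set zs' \<Longrightarrow> length zs = b \<Longrightarrow> length zs' = b \<Longrightarrow> g (ys @ zs) = g (ys @ zs')"
  shows "a / b * perm_avg Y g \<le>
    perm_avg Y (\<lambda>ys. of_bool (pack (drop (length ys - b) ys) = {}) * g ys)"
  using assms
proof (induction "card Y - b" arbitrary: Y g)
  case 0
  then have Y: "card Y = b" "finite Y" using finite_subset[OF _ finite_X] by auto
  obtain zs where zs: "set zs = Y" "distinct zs" using finite_distinct_list[OF Y(2)] by auto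
  \<comment> \<open>All of \<open>Y\<close> belongs to the first \<open>b\<close> arrivals, so
    \<open>g\<close> is constant on the orders of \<open>Y\<close>, and
    \<open>perm_avg_all_blocked\<close> supplies the factor \<open>a / b\<close>.\<close>
  have g: "g ys = g zs" if "distinct ys" "set ys = Y" for ys
    using 0(5)[of ys zs "[]"] that zs Y by (metis append_Nil distinct_card)
  have "a / b * perm_avg Y g = g zs * (a / b)"
  proof -
    have "perm_avg Y g = perm_avg Y (\<lambda>_. g zs)" using g by (rule perm_avg_cong)
    then show ?thesis using Y by (simp add: perm_avg_const)
  qed
  also have "\<dots> \<le> g zs * perm_avg Y (\<lambda>ys. of_bool (\<forall>w\<in>Y. big w \<longrightarrow> blocked a W s v ys w))"
    using perm_avg_all_blocked[of Y a W s v] Y a_less 0(4) by (intro mult_left_mono) fastforce+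
  also have "\<dots> \<le> g zs * perm_avg Y (\<lambda>ys. of_bool (pack (drop (length ys - b) ys) = {}))"
  proof (intro mult_left_mono perm_avg_mono)
    fix ys assume ys: "distinct ys" "set ys = Y"
    then have "length ys = b" using Y by (metis distinct_card)
    then show "of_bool (\<forall>w\<in>Y. big w \<longrightarrow> blocked a W s v ys w) \<le>
      (of_bool (pack (drop (length ys - b) ys) = {}) :: real)"
      using ys run_eq_empty[of ys b W s a v] by auto
  qed (use 0 in auto)
  also have "\<dots> = perm_avg Y (\<lambda>ys. of_bool (pack (drop (length ys - b) ys) = {}) * g ys)"
    unfolding perm_avg_mult[symmetric]
  proof (rule perm_avg_cong)
    fix ys assume "distinct ys" "set ys = Y"
    from g[OF this] show "g zs * of_bool (pack (drop (length ys - b) ys) = {}) =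
      of_bool (pack (drop (length ys - b) ys) = {}) * g ys" by simp
  qed
  finally show ?case .
next
  case (Suc k)
  have fin: "finite Y" "Y \<noteq> {}" using Suc by (auto intro: finite_subset[OF _ finite_X])
  \<comment> \<open>Conditioning on the latest arrival \<open>x\<close> leaves the first
    \<open>b\<close> arrivals untouched, and \<open>\<lambda>ys. g (x # ys)\<close> inherits the
    invariance of \<open>g\<close>.\<close>
  have "a / b * perm_avg Y g = (\<Sum>x\<in>Y. a / b * perm_avg (Y - {x}) (\<lambda>ys. g (x # ys))) / card Y"
    using fin by (simp add: perm_avg_Cons sum_distrib_left)
  also have "\<dots> \<le> (\<Sum>x\<in>Y. perm_avg (Y - {x})
      (\<lambda>ys. of_bool (pack (drop (length ys - b) ys) = {}) * g (x # ys))) / card Y"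
  proof (intro divide_right_mono sum_mono Suc.hyps(1))
    fix x ys zs zs' assume "set zs = set (zs' :: 'a list)" "length zs = b" "length zs' = b"
    then show "g (x # ys @ zs) = g (x # ys @ zs')" using Suc.prems(4)[of zs zs' "x # ys"] by simp
  qed (use Suc fin in auto)
  also have "\<dots> = (\<Sum>x\<in>Y. perm_avg (Y - {x})
      (\<lambda>ys. of_bool (pack (drop (length (x # ys) - b) (x # ys)) = {}) * g (x # ys))) / card Y"
  proof (intro arg_cong2[of _ _ _ _ "(/)"] sum.cong refl perm_avg_cong)
    fix x ys assume "x \<in> Y" "distinct ys" "set ys = Y - {x}"
    then have "length ys = card Y - 1" using fin by (metis card_Diff_singleton distinct_card)
    then have "b \<le> length ys" using Suc.hyps(2) by simp
    then show "of_bool (pack (drop (length ys - b) ys) = {}) * g (x # ys) =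
      of_bool (pack (drop (length (x # ys) - b) (x # ys)) = {}) * g (x # ys)"
      by (simp add: Suc_diff_le)
  qed
  also have "\<dots> = perm_avg Y (\<lambda>ys. of_bool (pack (drop (length ys - b) ys) = {}) * g ys)"
    using fin by (rule perm_avg_Cons[symmetric])
  finally show ?case .
qed

text \<open>Truncated at 0 to be nonnegative for every \<open>m\<close>, as
  \<open>gain_small\<close> multiplies inequalities by it. The factor \<open>a / b\<close> bounds
  the probability of having packed no large item, the other factor that of having space
  left.\<close>

definition "room m = max 0 (a / b * (1 - 3 / 2 * (\<Sum>j\<in>{b<..m}. 1 / real j)))"

text \<open>By Markov's inequality, since small items fit as long as at most \<open>2 / 3 * W\<close> is in use.\<close>

lemma prob_room:
  assumes "Y \<subseteq> X" "b \<le> card Y"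
  shows "room (card Y) \<le> perm_avg Y (\<lambda>ys. of_bool (pack (drop (length ys - b) ys) = {} \<and>
    sum s (tent ys) \<le> 2 / 3 * W))"
proof -
  let ?g = "\<lambda>ys. of_bool (sum s (tent ys) \<le> 2 / 3 * W) :: real"
  have fin: "finite Y" using assms finite_X finite_subset by blast
  have "1 - 3 / 2 * (\<Sum>j\<in>{b<..card Y}. 1 / real j) =
    1 - 3 / (2 * W) * (W * (\<Sum>j\<in>{b<..card Y}. 1 / real j))"
    using W_pos by simp
  also have "\<dots> \<le> 1 - 3 / (2 * W) * perm_avg Y (\<lambda>ys. sum s (tent ys))"
    using tentative_size[OF assms(1)] W_pos by (intro diff_left_mono mult_left_mono) auto
  also have "\<dots> = perm_avg Y (\<lambda>ys. 1 - 3 / (2 * W) * sum s (tent ys))"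
    using fin by (simp only: perm_avg_diff perm_avg_mult perm_avg_const)
  \<comment> \<open>Markov's inequality pointwise: where the size exceeds \<open>2 / 3 * W\<close>,
    the left-hand side is negative, and elsewhere it is at most 1.\<close>
  also have "\<dots> \<le> perm_avg Y ?g"
  proof (rule perm_avg_mono)
    fix ys assume "distinct ys" "set ys = Y"
    then have "tent ys \<subseteq> X" using tentative_subset[of b W s v ys] assms(1) by auto
    then have "0 \<le> sum s (tent ys)" using s_pos by (intro sum_nonneg) (auto intro: less_imp_le)
    then show "1 - 3 / (2 * W) * sum s (tent ys) \<le> ?g ys"
      using W_pos by (auto simp: field_simps)
  qed
  finally have "a / b * (1 - 3 / 2 * (\<Sum>j\<in>{b<..card Y}. 1 / real j)) \<le> a / b * perm_avg Y ?g"
    by (intro mult_left_mono) auto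
  also have "\<dots> \<le> perm_avg Y (\<lambda>ys. of_bool (pack (drop (length ys - b) ys) = {}) * ?g ys)"
  proof (rule no_large_packed_indep)
    fix ys zs zs' :: "'a list" assume "set zs = set zs'" "length zs = b" "length zs' = b"
    from tentative_append_cong[OF this] show "?g (ys @ zs) = ?g (ys @ zs')" by (rule arg_cong)
  qed (use assms in auto)
  also have "\<dots> = perm_avg Y (\<lambda>ys. of_bool (pack (drop (length ys - b) ys) = {} \<and>
    sum s (tent ys) \<le> 2 / 3 * W))"
    by (simp add: of_bool_conj)
  finally show ?thesis
    unfolding room_def by (simp add: perm_avg_nonneg)
qed

text \<open>Everything packed is small and tentatively chosen, so at most \<open>2 / 3 * W\<close>
  is in use, and \<open>x\<close> needs at most \<open>W / 3\<close>.\<close>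

lemma accept_small:
  assumes "distinct (x # ys)" "set (x # ys) \<subseteq> X" "b \<le> length ys"
    "x \<in> opt_packing W s v {i \<in> set (x # ys). 3 * s i \<le> W}"
    "pack (drop (length ys - b) ys) = {}" "sum s (tent ys) \<le> 2 / 3 * W"
  shows "acc (pack ys) ys x"
proof -
  have x: "3 * s x \<le> W"
    using assms(4) opt_packing(1)[of "{i \<in> set (x # ys). 3 * s i \<le> W}" W s v] W_pos by auto
  have sub: "pack ys \<subseteq> tent ys \<inter> {i. 3 * s i \<le> W}"
    using assms by (intro run_subset_tentative) auto
  have "tent ys \<subseteq> X" using assms(2) tentative_subset[of b W s v ys] by auto
  then have "sum s (pack ys) \<le> sum s (tent ys)"
    using sub s_pos by (intro sum_mono2) (auto intro: less_imp_le)
  then have "sum s (pack ys) + s x \<le> W" using assms(6) x by simp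
  then show ?thesis using x sub assms(3,4) by (auto simp: accepts_def)
qed

text \<open>The optimal packing of the small items in \<open>S\<close> is worth at least as much as
  \<open>T\<close>. Each of its items is last with probability \<open>1 / card S\<close> and is then
  packed with probability at least \<open>room (card S - 1)\<close>.\<close>

lemma gain_small:
  assumes "S \<subseteq> X" "b < card S" "T \<subseteq> S" "sum s T \<le> W" "\<And>i. i \<in> T \<Longrightarrow> 3 * s i \<le> W"
  shows "room (card S - 1) * sum v T / card S \<le> perm_avg S (gain a b W s v)"
proof -
  let ?M = "opt_packing W s v {i \<in> S. 3 * s i \<le> W}"
  have fin: "finite S" using assms finite_X finite_subset by blast
  have M: "?M \<subseteq> {i \<in> S. 3 * s i \<le> W}" "sum v T \<le> sum v ?M"
    using opt_packing(1)[of "{i \<in> S. 3 * s i \<le> W}" W s v]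
      opt_packing(3)[of "{i \<in> S. 3 * s i \<le> W}" W T s v] fin W_pos assms by auto
  have room_nonneg: "0 \<le> room m" for m by (simp add: room_def)
  have "room (card S - 1) * sum v T \<le> room (card S - 1) * sum v ?M"
    using M room_nonneg by (intro mult_left_mono) auto
  also have "\<dots> = (\<Sum>x\<in>?M. v x * room (card S - 1))"
    by (simp add: sum_distrib_left mult.commute)
  also have "\<dots> \<le> (\<Sum>x\<in>?M. v x * perm_avg (S - {x}) (\<lambda>ys. of_bool (acc (pack ys) ys x)))"
  proof (intro sum_mono mult_left_mono)
    fix x assume x: "x \<in> ?M"
    then have xS: "x \<in> S" using M by auto
    have c: "card (S - {x}) = card S - 1" using xS fin by simp
    have "room (card S - 1) \<le> perm_avg (S - {x}) (\<lambda>ys. of_bool (pack (drop (length ys - b) ys) = {} \<and>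
      sum s (tent ys) \<le> 2 / 3 * W))"
      unfolding c[symmetric] using assms c by (intro prob_room) auto
    also have "\<dots> \<le> perm_avg (S - {x}) (\<lambda>ys. of_bool (acc (pack ys) ys x))"
    proof (rule perm_avg_mono)
      fix ys assume ys: "distinct ys" "set ys = S - {x}"
      then have "length ys = card S - 1" using c by (metis distinct_card)
      moreover have "set (x # ys) = S" using ys xS by auto
      ultimately have "acc (pack ys) ys x" if "pack (drop (length ys - b) ys) = {}" "sum s (tent ys) \<le> 2 / 3 * W"
        using that ys x assms by (intro accept_small) auto
      then show "of_bool (pack (drop (length ys - b) ys) = {} \<and> sum s (tent ys) \<le> 2 / 3 * W) \<le>
        (of_bool (acc (pack ys) ys x) :: real)" by (auto simp: of_bool_def)
    qed
    finally show "room (card S - 1) \<le> perm_avg (S - {x}) (\<lambda>ys. of_bool (acc (pack ys) ys x))" .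
    show "0 \<le> v x" using xS assms v_nonneg by auto
  qed
  finally have *: "room (card S - 1) * sum v T / card S \<le>
    (\<Sum>x\<in>?M. v x * perm_avg (S - {x}) (\<lambda>ys. of_bool (acc (pack ys) ys x))) / card S"
    by (rule divide_right_mono) simp
  show ?thesis
  proof (cases "?M = {}")
    case True
    then show ?thesis using * assms perm_gain_nonneg[of S] by simp
  next
    case False
    then show ?thesis using * perm_avg_gain_ge[of S ?M] M(1) assms(1) by fastforce
  qed
qed

text \<open>Each item of \<open>T\<close> is in the random \<open>S\<close> with probability
  \<open>Suc m / n\<close>, and \<open>T \<inter> S\<close> still fits, so \<open>gain_small\<close>
  applies to it; the factor \<open>Suc m\<close> cancels.\<close>

lemma round_gain_small:
  assumes "b \<le> m" "m < n" "T \<subseteq> X" "sum s T \<le> W" "\<And>i. i \<in> T \<Longrightarrow> 3 * s i \<le> W"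
  shows "room m * sum v T / n \<le> round_gain (Suc m)"
proof -
  let ?c = "room m / real (Suc m)"
  have finT: "finite T" using assms finite_X finite_subset by blast
  have "room m * sum v T / n = ?c * (\<Sum>x\<in>T. v x * (1 - (real n - Suc m) / n))"
  proof -
    have "1 - (real n - Suc m) / n = real (Suc m) / n"
      using assms by (simp add: field_simps del: of_nat_Suc)
    then show ?thesis by (simp add: sum_divide_distrib[symmetric] sum_distrib_right[symmetric] del: of_nat_Suc)
  qed
  also have "\<dots> = ?c * (\<Sum>x\<in>T. subset_avg X (Suc m) (\<lambda>S. v x * (1 - of_bool (S \<inter> {x} = {}))))"
  proof (intro arg_cong2[of _ _ _ _ "(*)"] sum.cong refl)
    fix x assume "x \<in> T"
    then have "x \<in> X" "Suc m \<le> n" using assms by auto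
    then show "v x * (1 - (real n - Suc m) / n) =
        subset_avg X (Suc m) (\<lambda>S. v x * (1 - of_bool (S \<inter> {x} = {})))"
      using finite_X by (simp only: subset_avg_mult subset_avg_diff subset_avg_const subset_avg_miss)
  qed
  also have "\<dots> = subset_avg X (Suc m) (\<lambda>S. ?c * (\<Sum>x\<in>T. v x * (1 - of_bool (S \<inter> {x} = {}))))"
    by (simp only: subset_avg_mult subset_avg_sum)
  also have "\<dots> \<le> round_gain (Suc m)"
  proof (rule subset_avg_mono)
    fix S assume S: "S \<subseteq> X" "card S = Suc m"
    have "(\<Sum>x\<in>T. v x * (1 - of_bool (S \<inter> {x} = {}))) = sum v (T \<inter> S)"
      using finT by (subst sum.inter_restrict) (auto intro!: sum.cong)
    then have "?c * (\<Sum>x\<in>T. v x * (1 - of_bool (S \<inter> {x} = {}))) =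
        room (card S - 1) * sum v (T \<inter> S) / card S" using S by simp
    also have "\<dots> \<le> perm_avg S (gain a b W s v)"
    proof (rule gain_small)
      have "sum s (T \<inter> S) \<le> sum s T"
        using assms finT s_pos by (intro sum_mono2) (auto intro: less_imp_le)
      then show "sum s (T \<inter> S) \<le> W" using assms by simp
    qed (use S assms in auto)
    finally show "?c * (\<Sum>x\<in>T. v x * (1 - of_bool (S \<inter> {x} = {}))) \<le> perm_avg S (gain a b W s v)" .
  qed
  finally show ?thesis .
qed


section \<open>Combining large and small items\<close>

lemma card_big_le_2:
  assumes "T \<subseteq> X" "sum s T \<le> W" "\<And>i. i \<in> T \<Longrightarrow> big i"
  shows "card T \<le> 2"
proof (rule ccontr)
  assume "\<not> card T \<le> 2"
  then have T: "T \<noteq> {}" "finite T" "3 \<le> card T" using assms finite_X finite_subset by auto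
  have "3 * W \<le> card T * W" using T(3) W_pos by simp
  also have "\<dots> < (\<Sum>i\<in>T. 3 * s i)"
    using T assms(3) sum_strict_mono[of T "\<lambda>_. W" "\<lambda>i. 3 * s i"] by simp
  also have "\<dots> = 3 * sum s T" by (simp add: sum_distrib_left)
  finally show False using assms(2) by simp
qed

text \<open>\<open>single\<close> serves one large item, \<open>pair\<close> the two best, and
  \<open>triple\<close> any other two. In the last two cases \<open>single\<close> also covers the
  extreme point \<open>(1, 0)\<close> of \<open>two_weights\<close>.\<close>

lemma large_phase:
  fixes \<alpha> :: real
  assumes \<alpha>: "0 \<le> \<alpha>"
    and single: "\<alpha> \<le> (\<Sum>m\<in>{a..<b}. a / (real m * n))"
    and pair: "2 * \<alpha> \<le> (\<Sum>m\<in>{a..<b}. a / (real m * n) + a * (real n - 1 - m) / (real m * (real n)\<^sup>2) +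
        2 * (a * (real m - a) / (real m * (real n)\<^sup>2)))"
    and triple: "2 * \<alpha> \<le> (\<Sum>m\<in>{a..<b}. a / (real m * n) +
        a / (real m * n) * ((real n - Suc m) / n + ((real n - Suc m) / n)\<^sup>2))"
    and T: "T \<subseteq> X" "sum s T \<le> W" "\<And>i. i \<in> T \<Longrightarrow> big i"
  shows "\<alpha> * sum v T \<le> (\<Sum>m\<in>{a..<b}. round_gain (Suc m))"
proof (cases "T = {}")
  case True
  then show ?thesis using round_gain_nonneg by (auto intro: sum_nonneg)
next
  case False
  define B where "B = {w\<in>X. big w}"
  have B: "finite B" "T \<subseteq> B" using finite_X T by (auto simp: B_def)
  then have "B \<noteq> {}" using False by auto
  then obtain x where x: "x \<in> B" "\<And>w. w \<in> B \<Longrightarrow> w \<noteq> x \<Longrightarrow> beats v x w"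
    using exists_best[OF B(1)] by blast
  have xge: "v w \<le> v x" if "w \<in> B" for w
    using x(2)[OF that] beats_imp_ge[of v x w] by (cases "w = x") auto
  have "card T \<le> 2" "card T \<noteq> 0" using card_big_le_2[OF T] False finite_subset[OF B(2,1)] by auto
  then consider "card T = 1" | "card T = 2" by linarith
  then show ?thesis
  proof cases
    case 1
    then obtain i where i: "T = {i}" by (auto simp: card_1_singleton_iff)
    have "\<alpha> * sum v T \<le> v x * (\<Sum>m\<in>{a..<b}. a / (real m * n))"
      unfolding mult.commute[of \<alpha>]
      using single \<alpha> i B xge[of i] v_nonneg[of i] T by (intro mult_mono) (auto intro: order_trans)
    also have "\<dots> = (\<Sum>m\<in>{a..<b}. v x * (a / (real m * n)))" by (rule sum_distrib_left)
    also have "\<dots> \<le> (\<Sum>m\<in>{a..<b}. round_gain (Suc m))"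
      using x by (intro sum_mono round_gain_best) (auto simp: B_def)
    finally show ?thesis .
  next
    case 2
    then obtain i j where ij: "T = {i, j}" "i \<noteq> j" by (auto simp: card_2_iff)
    have "B - {x} \<noteq> {}" using ij B by auto
    then obtain y where y: "y \<in> B - {x}" "\<And>w. w \<in> B - {x} \<Longrightarrow> w \<noteq> y \<Longrightarrow> beats v y w"
      using exists_best[of "B - {x}" v] B(1) by blast
    have yge: "v w \<le> v y" if "w \<in> B" "w \<noteq> x" for w
      using y(2)[of w] that beats_imp_ge[of v y w] by (cases "w = y") auto
    show ?thesis
    proof (cases "T = {x, y}")
      case True
      have xy: "x \<noteq> y" "s x + s y \<le> W" "sum v T = v x + v y" using True y(1) T(2) by auto
      define q where "q m = a * (real m - a) / (real m * (real n)\<^sup>2)" for m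
      define p r where "p m = a / (real m * n)" and
        "r m = a * (real n - 1 - m) / (real m * (real n)\<^sup>2)" for m
      have "\<alpha> * sum v T \<le> v x * (\<Sum>m\<in>{a..<b}. p m + q m) + v y * (\<Sum>m\<in>{a..<b}. r m + q m)"
        unfolding xy(3)
      proof (rule two_weights)
        have "0 \<le> q m" if "m \<in> {a..<b}" for m using that by (auto simp: q_def)
        then show "\<alpha> \<le> (\<Sum>m\<in>{a..<b}. p m + q m)"
          using single sum_nonneg[of "{a..<b}" q] unfolding p_def[symmetric] sum.distrib by force
        show "2 * \<alpha> \<le> (\<Sum>m\<in>{a..<b}. p m + q m) + (\<Sum>m\<in>{a..<b}. r m + q m)"
          using pair unfolding p_def[symmetric] q_def[symmetric] r_def[symmetric]
          by (simp add: sum.distrib sum_distrib_left[symmetric])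
        show "v y \<le> v x" using xge y by auto
        show "0 \<le> v y" using y v_nonneg by (auto simp: B_def)
      qed
      also have "\<dots> = (\<Sum>m\<in>{a..<b}. v x * (p m + q m) + v y * (r m + q m))"
        unfolding sum_distrib_left by (rule sum.distrib[symmetric])
      also have "\<dots> \<le> (\<Sum>m\<in>{a..<b}. round_gain (Suc m))"
        unfolding p_def q_def r_def using x y xy
        by (intro sum_mono round_gain_best_pair) (auto simp: B_def)
      finally show ?thesis .
    next
      case False
      \<comment> \<open>As \<open>z\<close> is neither of the two best large items, its profit is at
        most that of \<open>y\<close>; the profit of \<open>w\<close> is bounded by that of
        \<open>x\<close>.\<close>
      have "\<exists>z w. T = {w, z} \<and> w \<noteq> z \<and> z \<notin> {x, y}"
      proof (cases "i \<in> {x, y}")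
        case True
        then have "j \<notin> {x, y}" using False ij by auto
        then show ?thesis using ij by blast
      next
        case False
        have "T = {j, i}" using ij by auto
        then show ?thesis using False ij by blast
      qed
      then obtain w z where wz: "T = {w, z}" "w \<noteq> z" "z \<notin> {x, y}" by blast
      have zB: "z \<in> B" "w \<in> B" using wz B by auto
      define p r where "p m = a / (real m * n)" and
        "r m = p m * ((real n - Suc m) / n + ((real n - Suc m) / n)\<^sup>2)" for m
      have "\<alpha> * sum v T = \<alpha> * (v w + v z)" using wz by simp
      also have "\<dots> \<le> \<alpha> * (v x + v z)" using xge zB \<alpha> by (intro mult_left_mono) auto
      also have "\<dots> \<le> v x * (\<Sum>m\<in>{a..<b}. p m) + v z * (\<Sum>m\<in>{a..<b}. r m)"
      proof (rule two_weights)
        show "\<alpha> \<le> (\<Sum>m\<in>{a..<b}. p m)" using single unfolding p_def .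
        show "2 * \<alpha> \<le> (\<Sum>m\<in>{a..<b}. p m) + (\<Sum>m\<in>{a..<b}. r m)"
          using triple unfolding p_def[symmetric] r_def[symmetric] by (simp only: sum.distrib)
        show "v z \<le> v x" using xge zB by auto
        show "0 \<le> v z" using zB v_nonneg by (auto simp: B_def)
      qed
      also have "\<dots> = (\<Sum>m\<in>{a..<b}. v x * p m + v z * r m)"
        unfolding sum_distrib_left by (rule sum.distrib[symmetric])
      also have "\<dots> \<le> (\<Sum>m\<in>{a..<b}. round_gain (Suc m))"
        unfolding r_def p_def
      proof (intro sum_mono)
        fix m assume "m \<in> {a..<b}"
        then show "v x * (a / (real m * n)) + v z * (a / (real m * n) *
           ((real n - Suc m) / n + ((real n - Suc m) / n)\<^sup>2)) \<le> round_gain (Suc m)"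
          using x y wz zB yge by (intro round_gain_best3[where y = y]) (auto simp: B_def)
      qed
      finally show ?thesis .
    qed
  qed
qed

lemma small_phase:
  fixes \<alpha> :: real
  assumes small: "\<alpha> \<le> (\<Sum>m\<in>{b..<n}. a / b * (1 - 3 / 2 * (\<Sum>j\<in>{b<..m}. 1 / real j))) / n"
    and T: "T \<subseteq> X" "sum s T \<le> W" "\<And>i. i \<in> T \<Longrightarrow> 3 * s i \<le> W"
  shows "\<alpha> * sum v T \<le> (\<Sum>m\<in>{b..<n}. round_gain (Suc m))"
proof -
  have "(\<Sum>m\<in>{b..<n}. a / b * (1 - 3 / 2 * (\<Sum>j\<in>{b<..m}. 1 / real j))) \<le> (\<Sum>m\<in>{b..<n}. room m)"
    by (intro sum_mono) (simp add: room_def)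
  then have "\<alpha> \<le> (\<Sum>m\<in>{b..<n}. room m) / n"
    using small by (elim order_trans) (auto intro: divide_right_mono)
  then have "\<alpha> * sum v T \<le> (\<Sum>m\<in>{b..<n}. room m) / n * sum v T"
    using T v_nonneg by (intro mult_right_mono sum_nonneg) auto
  also have "\<dots> = (\<Sum>m\<in>{b..<n}. room m * sum v T / n)"
    by (simp add: sum_distrib_right sum_divide_distrib)
  also have "\<dots> \<le> (\<Sum>m\<in>{b..<n}. round_gain (Suc m))"
    using T by (intro sum_mono round_gain_small) auto
  finally show ?thesis .
qed

text \<open>The large and the small part of \<open>T\<close> fit separately and are paid for by
  disjoint ranges of rounds, so the two guarantees add up with the same ratio.\<close>

lemma competitive:
  fixes \<alpha> :: real
  assumes "0 \<le> \<alpha>" "\<alpha> \<le> (\<Sum>m\<in>{a..<b}. a / (real m * n))"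
    "2 * \<alpha> \<le> (\<Sum>m\<in>{a..<b}. a / (real m * n) + a * (real n - 1 - m) / (real m * (real n)\<^sup>2) +
        2 * (a * (real m - a) / (real m * (real n)\<^sup>2)))"
    "2 * \<alpha> \<le> (\<Sum>m\<in>{a..<b}. a / (real m * n) +
        a / (real m * n) * ((real n - Suc m) / n + ((real n - Suc m) / n)\<^sup>2))"
    "\<alpha> \<le> (\<Sum>m\<in>{b..<n}. a / b * (1 - 3 / 2 * (\<Sum>j\<in>{b<..m}. 1 / real j))) / n"
    and T: "T \<subseteq> X" "sum s T \<le> W"
  shows "\<alpha> * sum v T \<le> perm_avg X (\<lambda>ys. sum v (pack ys))"
proof -
  have fin: "finite T" using T finite_X finite_subset by blast
  have s_sub: "sum s T' \<le> W" if "T' \<subseteq> T" for T'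
  proof -
    have "sum s T' \<le> sum s T" using that T fin s_pos by (intro sum_mono2) (auto intro: less_imp_le)
    then show ?thesis using T by simp
  qed
  have "T = {i\<in>T. big i} \<union> {i\<in>T. 3 * s i \<le> W}" by auto
  then have "sum v T = sum v ({i\<in>T. big i} \<union> {i\<in>T. 3 * s i \<le> W})" by (rule arg_cong)
  also have "\<dots> = sum v {i\<in>T. big i} + sum v {i\<in>T. 3 * s i \<le> W}"
    using fin by (intro sum.union_disjoint) auto
  finally have "\<alpha> * sum v T = \<alpha> * sum v {i\<in>T. big i} + \<alpha> * sum v {i\<in>T. 3 * s i \<le> W}"
    by (simp only: distrib_left)
  also have "\<dots> \<le> (\<Sum>m\<in>{a..<b}. round_gain (Suc m)) + (\<Sum>m\<in>{b..<n}. round_gain (Suc m))"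
  proof (rule add_mono)
    show "\<alpha> * sum v {i\<in>T. big i} \<le> (\<Sum>m\<in>{a..<b}. round_gain (Suc m))"
      by (rule large_phase[OF assms(1-4)]) (use T s_sub in auto)
    show "\<alpha> * sum v {i\<in>T. 3 * s i \<le> W} \<le> (\<Sum>m\<in>{b..<n}. round_gain (Suc m))"
      by (rule small_phase[OF assms(5)]) (use T s_sub in auto)
  qed
  also have "\<dots> = (\<Sum>m\<in>{a..<b} \<union> {b..<n}. round_gain (Suc m))"
    by (subst sum.union_disjoint) auto
  also have "\<dots> \<le> (\<Sum>m<n. round_gain (Suc m))"
    using a_less b_le round_gain_nonneg by (intro sum_mono2) auto
  also have "\<dots> = perm_avg X (\<lambda>ys. sum v (pack ys))" by (rule perm_avg_run_eq[symmetric])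
  finally show ?thesis .
qed

end

subsection \<open>Asymptotics\<close>

text \<open>Telescoping of \<open>ln (1 + 1 / m) \<le> 1 / m\<close>.\<close>

lemma ln_le_sum_inverse:
  assumes "0 < a" "a \<le> b"
  shows "ln (real b / a) \<le> (\<Sum>m\<in>{a..<b}. 1 / real m)"
  using assms(2)
proof (induction rule: dec_induct)
  case base
  then show ?case using assms by simp
next
  case (step m)
  have m: "0 < real m" using step assms by simp
  have "real (Suc m) / a = real m / a * (1 + 1 / m)"
    using m assms by (simp add: field_simps)
  then have "ln (real (Suc m) / a) = ln (real m / a * (1 + 1 / m))" by (rule arg_cong)
  also have "\<dots> = ln (real m / a) + ln (1 + 1 / m)"
    using m assms by (intro ln_mult_pos divide_pos_pos add_pos_pos) auto
  also have "\<dots> \<le> (\<Sum>m\<in>{a..<m}. 1 / real m) + 1 / m"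
    using step.IH m by (intro add_mono ln_add_one_self_le_self) auto
  finally show ?case using step by simp
qed

text \<open>Telescoping of \<open>1 / (m + 1) \<le> ln ((m + 1) / m)\<close>, which is
  \<open>ln t \<le> t - 1\<close> at \<open>t = m / (m + 1)\<close>.\<close>

lemma sum_inverse_le_ln:
  assumes "0 < a" "a \<le> b"
  shows "(\<Sum>j\<in>{a<..b}. 1 / real j) \<le> ln (real b / a)"
  using assms(2)
proof (induction rule: dec_induct)
  case base
  then show ?case using assms by simp
next
  case (step m)
  have m: "0 < real m" using step assms by simp
  have "{a<..Suc m} = insert (Suc m) {a<..m}" using step by auto
  then have "(\<Sum>j\<in>{a<..Suc m}. 1 / real j) = 1 / real (Suc m) + (\<Sum>j\<in>{a<..m}. 1 / real j)" by simp
  also have "\<dots> \<le> - ln (real m / real (Suc m)) + ln (real m / a)"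
  proof (rule add_mono)
    have "ln (real m / real (Suc m)) \<le> real m / real (Suc m) - 1"
      using m by (intro ln_le_minus_one) auto
    also have "\<dots> = - (1 / real (Suc m))" by (simp add: field_simps)
    finally show "1 / real (Suc m) \<le> - ln (real m / real (Suc m))" by simp
  qed (rule step.IH)
  also have "\<dots> = ln (real (Suc m) / a)"
    using m assms by (simp add: ln_div)
  finally show ?case .
qed

text \<open>Each \<open>1 / j\<close> is counted once for every \<open>m\<close> from
  \<open>j\<close> to \<open>n - 1\<close>, so the double sum is that of
  \<open>(n - j) / j\<close>.\<close>

lemma sum_partial_inverse:
  assumes "b \<le> n"
  shows "(\<Sum>m\<in>{b..<n}. \<Sum>j\<in>{b<..m}. 1 / real j) = n * (\<Sum>j\<in>{b<..n}. 1 / real j) - (real n - b)"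
  using assms
proof (induction rule: dec_induct)
  case (step m)
  have "{b<..Suc m} = insert (Suc m) {b<..m}" using step by auto
  then have e: "(\<Sum>j\<in>{b<..Suc m}. 1 / real j) = 1 / real (Suc m) + (\<Sum>j\<in>{b<..m}. 1 / real j)" by simp
  show ?case unfolding e using step by (simp add: distrib_left) (simp add: algebra_simps add_divide_distrib[symmetric])
qed simp

lemma sum_atLeastLessThan_nat:
  assumes "a \<le> b"
  shows "(\<Sum>m\<in>{a..<b}. real m) = (real b * (real b - 1) - real a * (real a - 1)) / 2"
  using assms by (induction rule: dec_induct) (auto simp: field_simps)

text \<open>The right-hand sides are Riemann sums; \<open>x\<close> and \<open>y\<close> tend to the points where the first two
  phases end, relative to \<open>n\<close>, and \<open>e\<close> tends to 0.\<close>

lemma phase_sums_ge: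
  fixes a b n :: nat
  assumes "2 \<le> a" "a < b" "b \<le> n"
  defines "x \<equiv> real a / n" and "y \<equiv> real b / n" and "e \<equiv> 1 / real n"
  shows "x * ln (y / x) \<le> (\<Sum>m\<in>{a..<b}. a / (real m * n))"
    "x * (ln (y / x) * (2 - e - 2 * x) + (y - x)) \<le>
       (\<Sum>m\<in>{a..<b}. a / (real m * n) + a * (real n - 1 - m) / (real m * (real n)\<^sup>2) +
        2 * (a * (real m - a) / (real m * (real n)\<^sup>2)))"
    "x * (ln (y / x) * (1 + (1 - e) + (1 - e)\<^sup>2) - (1 + 2 * (1 - e)) * (y - x) + (y\<^sup>2 - x\<^sup>2 - e * (y - x)) / 2) \<le>
       (\<Sum>m\<in>{a..<b}. a / (real m * n) +
        a / (real m * n) * ((real n - Suc m) / n + ((real n - Suc m) / n)\<^sup>2))"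
    "x / y * ((1 - y) - 3 / 2 * (ln (1 / y) - (1 - y))) \<le>
       (\<Sum>m\<in>{b..<n}. a / b * (1 - 3 / 2 * (\<Sum>j\<in>{b<..m}. 1 / real j))) / n"
proof -
  have n: "real n > 0" "real a > 0" "real b > 0" using assms by auto
  define h where "h = (\<Sum>m\<in>{a..<b}. 1 / real m)"
  have yx: "y / x = real b / a" using n by (simp add: x_def y_def)
  have h: "ln (y / x) \<le> h"
    unfolding yx h_def using assms by (intro ln_le_sum_inverse) auto
  \<comment> \<open>These bounds make the factors of the harmonic sum \<open>h\<close> nonnegative,
    so that \<open>h\<close> may be replaced by its lower bound; \<open>x + e \<le> 1\<close>
    restates \<open>a + 1 \<le> n\<close>.\<close>
  have e: "0 \<le> e" "e \<le> 1/2" "x \<ge> 0" "x + e \<le> 1" using n assms by (auto simp: e_def x_def field_simps)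
  have cardsum: "(\<Sum>m\<in>{a..<b}. c) = (real b - a) * c" for c using assms by (simp add: of_nat_diff)
  have 1: "(\<Sum>m\<in>{a..<b}. a / (real m * n)) = x * h"
    unfolding h_def sum_distrib_left by (intro sum.cong) (auto simp: x_def)
  show "x * ln (y / x) \<le> (\<Sum>m\<in>{a..<b}. a / (real m * n))"
    unfolding 1 using h e by (intro mult_left_mono) auto
  \<comment> \<open>Each summand is affine in \<open>1 / m\<close>; the constants
    \<open>x * e\<close> add up to \<open>x * (y - x)\<close>.\<close>
  have "(\<Sum>m\<in>{a..<b}. a / (real m * n) + a * (real n - 1 - m) / (real m * (real n)\<^sup>2) +
        2 * (a * (real m - a) / (real m * (real n)\<^sup>2))) =
      (\<Sum>m\<in>{a..<b}. x * (2 - e - 2 * x) * (1 / real m) + x * e)"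
    by (intro sum.cong refl)
       (use assms n in \<open>auto simp: x_def e_def power2_eq_square field_simps\<close>)
  also have "\<dots> = x * (h * (2 - e - 2 * x) + (y - x))"
    unfolding sum.distrib cardsum sum_distrib_left[symmetric] h_def[symmetric]
    using n by (simp add: x_def y_def e_def field_simps)
  also have "\<dots> \<ge> x * (ln (y / x) * (2 - e - 2 * x) + (y - x))"
    using h e by (intro mult_left_mono add_mono mult_right_mono) auto
  finally show "x * (ln (y / x) * (2 - e - 2 * x) + (y - x)) \<le>
       (\<Sum>m\<in>{a..<b}. a / (real m * n) + a * (real n - 1 - m) / (real m * (real n)\<^sup>2) +
        2 * (a * (real m - a) / (real m * (real n)\<^sup>2)))" .
  have "(\<Sum>m\<in>{a..<b}. a / (real m * n) +
        a / (real m * n) * ((real n - Suc m) / n + ((real n - Suc m) / n)\<^sup>2)) =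
     (\<Sum>m\<in>{a..<b}. x * (1 + (1 - e) + (1 - e)\<^sup>2) * (1 / real m) - x * e * (1 + 2 * (1 - e)) + x * e\<^sup>2 * real m)"
  proof (intro sum.cong refl)
    fix m assume m: "m \<in> {a..<b}"
    have u: "(real n - Suc m) / n = (1 - e) - e * real m"
      using n by (simp add: e_def field_simps)
    have p: "a / (real m * n) = x * (1 / real m)" by (simp add: x_def)
    have "real m \<noteq> 0" using m assms by auto
    then show "a / (real m * n) + a / (real m * n) * ((real n - Suc m) / n + ((real n - Suc m) / n)\<^sup>2) =
      x * (1 + (1 - e) + (1 - e)\<^sup>2) * (1 / real m) - x * e * (1 + 2 * (1 - e)) + x * e\<^sup>2 * real m"
      unfolding u p by (simp add: field_simps power2_eq_square)
  qed
  also have "\<dots> = x * (h * (1 + (1 - e) + (1 - e)\<^sup>2) - (1 + 2 * (1 - e)) * (e * (real b - a)) +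
       e\<^sup>2 * ((real b * (real b - 1) - real a * (real a - 1)) / 2))"
    unfolding sum.distrib sum_subtractf cardsum sum_distrib_left[symmetric] h_def[symmetric]
      sum_atLeastLessThan_nat[OF less_imp_le[OF assms(2)]]
    by (simp add: algebra_simps)
  also have "e * (real b - a) = y - x" by (simp add: e_def x_def y_def diff_divide_distrib)
  also have "e\<^sup>2 * ((real b * (real b - 1) - real a * (real a - 1)) / 2) = (y\<^sup>2 - x\<^sup>2 - e * (y - x)) / 2"
    using n by (simp add: e_def x_def y_def field_simps power2_eq_square)
  also have "x * (h * (1 + (1 - e) + (1 - e)\<^sup>2) - (1 + 2 * (1 - e)) * (y - x) + (y\<^sup>2 - x\<^sup>2 - e * (y - x)) / 2) \<ge>
     x * (ln (y / x) * (1 + (1 - e) + (1 - e)\<^sup>2) - (1 + 2 * (1 - e)) * (y - x) + (y\<^sup>2 - x\<^sup>2 - e * (y - x)) / 2)"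
    using h e by (intro mult_left_mono add_mono diff_mono mult_right_mono) auto
  finally show "x * (ln (y / x) * (1 + (1 - e) + (1 - e)\<^sup>2) - (1 + 2 * (1 - e)) * (y - x) + (y\<^sup>2 - x\<^sup>2 - e * (y - x)) / 2) \<le>
       (\<Sum>m\<in>{a..<b}. a / (real m * n) +
        a / (real m * n) * ((real n - Suc m) / n + ((real n - Suc m) / n)\<^sup>2))" .
  define H where "H = (\<Sum>j\<in>{b<..n}. 1 / real j)"
  have H: "H \<le> ln (1 / y)"
    unfolding H_def y_def using sum_inverse_le_ln[of b n] assms by simp
  have "(\<Sum>m\<in>{b..<n}. a / b * (1 - 3 / 2 * (\<Sum>j\<in>{b<..m}. 1 / real j))) / n =
     a / b * ((real n - b) - 3 / 2 * (n * H - (real n - b))) / n"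
    unfolding sum_distrib_left[symmetric] sum_subtractf sum_partial_inverse[OF assms(3)] H_def[symmetric]
    using assms by (simp add: of_nat_diff)
  also have "\<dots> = x / y * ((1 - y) - 3 / 2 * (H - (1 - y)))"
    using n by (simp add: x_def y_def field_simps)
  also have "\<dots> \<ge> x / y * ((1 - y) - 3 / 2 * (ln (1 / y) - (1 - y)))"
    using H e by (intro mult_left_mono diff_mono) (auto simp: y_def)
  finally show "x / y * ((1 - y) - 3 / 2 * (ln (1 / y) - (1 - y))) \<le>
       (\<Sum>m\<in>{b..<n}. a / b * (1 - 3 / 2 * (\<Sum>j\<in>{b<..m}. 1 / real j))) / n" .
qed

section \<open>The end points of the phases\<close>

lemma nat_floor_bounds:
  assumes "0 \<le> (c :: real)"
  shows "real (nat \<lfloor>c * real n\<rfloor>) \<le> c * real n" "c * real n - 1 \<le> real (nat \<lfloor>c * real n\<rfloor>)"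
  using assms by (simp, linarith)

lemma tendsto_nat_floor_div:
  assumes "0 \<le> c"
  shows "(\<lambda>n. real (nat \<lfloor>c * real n\<rfloor>) / real n) \<longlonglongrightarrow> c"
proof (rule tendsto_sandwich)
  show "\<forall>\<^sub>F n in sequentially. c - 1 / real n \<le> real (nat \<lfloor>c * real n\<rfloor>) / real n"
    using eventually_gt_at_top[of 0]
  proof eventually_elim
    case (elim n)
    have "c * real n - 1 \<le> real (nat \<lfloor>c * real n\<rfloor>)" using assms by linarith
    then have "(c * real n - 1) / n \<le> real (nat \<lfloor>c * real n\<rfloor>) / n"
      by (rule divide_right_mono) simp
    then show ?case using elim by (simp add: diff_divide_distrib)
  qed
  show "\<forall>\<^sub>F n in sequentially. real (nat \<lfloor>c * real n\<rfloor>) / real n \<le> c"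
    using eventually_gt_at_top[of 0]
  proof eventually_elim
    case (elim n)
    have "real (nat \<lfloor>c * real n\<rfloor>) \<le> c * real n" using assms by simp
    then show ?case using elim by (simp add: field_simps)
  qed
  show "(\<lambda>n. c - 1 / real n) \<longlonglongrightarrow> c"
    using tendsto_diff[OF tendsto_const[of c] lim_1_over_n] by simp
qed auto

text \<open>These constants nearly equalise the guarantee for the large items, when the two best form the
  optimum, and the one for the small items; both exceed \<open>1 / 6.65\<close> by less than \<open>2 / 10\<^sup>5\<close>.\<close>

definition sample_end :: "nat \<Rightarrow> nat" where "sample_end n = nat \<lfloor>0.42291 * real n\<rfloor>"
definition large_end :: "nat \<Rightarrow> nat" where "large_end n = nat \<lfloor>0.6457 * real n\<rfloor>"

text \<open>Two of the limit inequalities hold with a margin of order \<open>10 ^ -5\<close> only,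
  so the logarithms are needed to several decimal places.\<close>

lemma ln_phase_bounds:
  "ln (0.6457 / 0.42291 :: real) > 0.423175"
  "ln (1 / 0.6457 :: real) < 0.437421"
proof -
  have "ln (0.6457 / 0.42291 :: real) \<ge> 0.4231751"
    using ln_approx_bounds[of "0.6457 / 0.42291" 4] by (simp add: eval_nat_numeral)
  then show "ln (0.6457 / 0.42291 :: real) > 0.423175" by simp
  have "ln (1 / 0.6457 :: real) \<le> 0.4374209"
    using ln_approx_bounds[of "1 / 0.6457" 4] by (simp add: eval_nat_numeral)
  then show "ln (1 / 0.6457 :: real) < 0.437421" by simp
qed

text \<open>Bundles what \<open>competitive\<close> requires of \<open>a\<close>, \<open>b\<close>
  and \<open>n\<close>. It fails for finitely many \<open>n\<close> only, which the
  \<open>o(1)\<close> term absorbs.\<close>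

definition good_length :: "nat \<Rightarrow> bool" where
  "good_length n \<longleftrightarrow> (let a = sample_end n; b = large_end n; \<alpha> = 1 / 6.65 in
     2 \<le> a \<and> a < b \<and> b \<le> n \<and>
     \<alpha> \<le> (\<Sum>m\<in>{a..<b}. a / (real m * n)) \<and>
     2 * \<alpha> \<le> (\<Sum>m\<in>{a..<b}. a / (real m * n) + a * (real n - 1 - m) / (real m * (real n)\<^sup>2) +
        2 * (a * (real m - a) / (real m * (real n)\<^sup>2))) \<and>
     2 * \<alpha> \<le> (\<Sum>m\<in>{a..<b}. a / (real m * n) +
        a / (real m * n) * ((real n - Suc m) / n + ((real n - Suc m) / n)\<^sup>2)) \<and>
     \<alpha> \<le> (\<Sum>m\<in>{b..<n}. a / b * (1 - 3 / 2 * (\<Sum>j\<in>{b<..m}. 1 / real j))) / n)"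

lemma good_lengthD:
  assumes "good_length n"
  shows "2 \<le> sample_end n" "sample_end n < large_end n" "large_end n \<le> n"
    and "1 / 6.65 \<le> (\<Sum>m\<in>{sample_end n..<large_end n}. sample_end n / (real m * n))"
    and "2 * (1 / 6.65) \<le> (\<Sum>m\<in>{sample_end n..<large_end n}. sample_end n / (real m * n) +
        sample_end n * (real n - 1 - m) / (real m * (real n)\<^sup>2) +
        2 * (sample_end n * (real m - sample_end n) / (real m * (real n)\<^sup>2)))"
    and "2 * (1 / 6.65) \<le> (\<Sum>m\<in>{sample_end n..<large_end n}. sample_end n / (real m * n) +
        sample_end n / (real m * n) * ((real n - Suc m) / n + ((real n - Suc m) / n)\<^sup>2))"
    and "1 / 6.65 \<le> (\<Sum>m\<in>{large_end n..<n}. sample_end n / large_end n *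
        (1 - 3 / 2 * (\<Sum>j\<in>{large_end n<..m}. 1 / real j))) / n"
  using assms unfolding good_length_def Let_def by blast+

text \<open>By \<open>phase_sums_ge\<close> it suffices that four expressions in \<open>x\<close>,
  \<open>y\<close> and \<open>e\<close> eventually exceed their thresholds, which follows from
  strict inequalities at the limits.\<close>

lemma eventually_good_length: "eventually good_length sequentially"
proof -
  define x y e where "x n = real (sample_end n) / real n" and "y n = real (large_end n) / real n"
    and "e n = 1 / real n" for n
  let ?c = "0.42291 :: real" and ?d = "0.6457 :: real"
  have x [tendsto_intros]: "x \<longlonglongrightarrow> ?c" and y [tendsto_intros]: "y \<longlonglongrightarrow> ?d"
    unfolding x_def y_def sample_end_def large_end_def by (intro tendsto_nat_floor_div; simp)+
  have e [tendsto_intros]: "e \<longlonglongrightarrow> 0" unfolding e_def by (rule lim_1_over_n)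
  have "\<forall>\<^sub>F n in sequentially. x n * ln (y n / x n) > 1 / 6.65"
  proof (rule order_tendstoD)
    show "(\<lambda>n. x n * ln (y n / x n)) \<longlonglongrightarrow> ?c * ln (?d / ?c)"
      by (intro tendsto_intros) auto
    show "1 / 6.65 < ?c * ln (?d / ?c)" using ln_phase_bounds(1) by simp
  qed
  moreover have "\<forall>\<^sub>F n in sequentially. x n * (ln (y n / x n) * (2 - e n - 2 * x n) + (y n - x n)) > 2 * (1 / 6.65)"
  proof (rule order_tendstoD)
    show "(\<lambda>n. x n * (ln (y n / x n) * (2 - e n - 2 * x n) + (y n - x n))) \<longlonglongrightarrow>
        ?c * (ln (?d / ?c) * (2 - 0 - 2 * ?c) + (?d - ?c))"
      by (intro tendsto_intros) auto
    show "2 * (1 / 6.65) < ?c * (ln (?d / ?c) * (2 - 0 - 2 * ?c) + (?d - ?c))"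
      using ln_phase_bounds(1) by simp
  qed
  moreover have "\<forall>\<^sub>F n in sequentially. x n * (ln (y n / x n) * (1 + (1 - e n) + (1 - e n)\<^sup>2) -
      (1 + 2 * (1 - e n)) * (y n - x n) + ((y n)\<^sup>2 - (x n)\<^sup>2 - e n * (y n - x n)) / 2) > 2 * (1 / 6.65)"
  proof (rule order_tendstoD)
    show "(\<lambda>n. x n * (ln (y n / x n) * (1 + (1 - e n) + (1 - e n)\<^sup>2) -
        (1 + 2 * (1 - e n)) * (y n - x n) + ((y n)\<^sup>2 - (x n)\<^sup>2 - e n * (y n - x n)) / 2)) \<longlonglongrightarrow>
        ?c * (ln (?d / ?c) * (1 + (1 - 0) + (1 - 0)\<^sup>2) -
        (1 + 2 * (1 - 0)) * (?d - ?c) + (?d\<^sup>2 - ?c\<^sup>2 - 0 * (?d - ?c)) / 2)"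
      by (intro tendsto_intros) auto
    show "2 * (1 / 6.65) < ?c * (ln (?d / ?c) * (1 + (1 - 0) + (1 - 0)\<^sup>2) -
        (1 + 2 * (1 - 0)) * (?d - ?c) + (?d\<^sup>2 - ?c\<^sup>2 - 0 * (?d - ?c)) / 2)"
      using ln_phase_bounds(1) by (simp add: power2_eq_square)
  qed
  moreover have "\<forall>\<^sub>F n in sequentially. x n / y n * ((1 - y n) - 3 / 2 * (ln (1 / y n) - (1 - y n))) > 1 / 6.65"
  proof (rule order_tendstoD)
    show "(\<lambda>n. x n / y n * ((1 - y n) - 3 / 2 * (ln (1 / y n) - (1 - y n)))) \<longlonglongrightarrow>
       ?c / ?d * ((1 - ?d) - 3 / 2 * (ln (1 / ?d) - (1 - ?d)))"
      by (intro tendsto_intros) auto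
    show "1 / 6.65 < ?c / ?d * ((1 - ?d) - 3 / 2 * (ln (1 / ?d) - (1 - ?d)))"
    proof -
      have "1 / 6.65 < ?c / ?d * ((1 - ?d) - 3 / 2 * (0.437421 - (1 - ?d)))" by simp
      also have "\<dots> < ?c / ?d * ((1 - ?d) - 3 / 2 * (ln (1 / ?d) - (1 - ?d)))"
        using ln_phase_bounds(2) by (intro mult_strict_left_mono) simp_all
      finally show ?thesis .
    qed
  qed
  \<comment> \<open>From this length on, rounding down cannot violate \<open>2 \<le> a\<close> or
    \<open>a < b\<close>; the value 1000 is a comfortable choice.\<close>
  moreover have "\<forall>\<^sub>F n in sequentially. (1000 :: nat) \<le> n" by (rule eventually_ge_at_top)
  ultimately show ?thesis
  proof eventually_elim
    case (elim n)
    have "2 \<le> sample_end n" "sample_end n < large_end n" "large_end n \<le> n"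
    proof -
      have "real (sample_end n) \<le> ?c * n" "?c * n - 1 \<le> real (sample_end n)"
        "real (large_end n) \<le> ?d * n" "?d * n - 1 \<le> real (large_end n)" "1000 \<le> real n"
        unfolding sample_end_def large_end_def using elim(5)
        by (intro nat_floor_bounds; simp | simp only: numeral_le_real_of_nat_iff)+
      then have "2 \<le> real (sample_end n)" "real (sample_end n) < real (large_end n)"
        "real (large_end n) \<le> real n" by simp_all
      then show "2 \<le> sample_end n" "sample_end n < large_end n" "large_end n \<le> n" by simp_all
    qed
    note abn = this and sums = phase_sums_ge[OF this, folded x_def y_def]
    show ?case
      unfolding good_length_def Let_def
      using abn order_trans[OF less_imp_le[OF elim(1)[unfolded e_def]] sums(1)]
        order_trans[OF less_imp_le[OF elim(2)[unfolded e_def]] sums(2)]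
        order_trans[OF less_imp_le[OF elim(3)[unfolded e_def]] sums(3)]
        order_trans[OF less_imp_le[OF elim(4)[unfolded e_def]] sums(4)]
      by (intro conjI)
  qed
qed

subsection \<open>Random tags\<close>

text \<open>The tag \<open>\<tau> ! t\<close> serves as the name of the item that arrives in round \<open>t\<close>.\<close>

definition tagged_rule :: "nat \<Rightarrow> rat \<Rightarrow> nat list \<Rightarrow> decision_rule" where
  "tagged_rule n W \<tau> L p =
     (let t = length L; val = map_of (zip (take (Suc t) \<tau>) (L @ [p]));
          s = (\<lambda>j. real_of_rat (fst (the (val j)))); v = (\<lambda>j. real_of_rat (snd (the (val j))));
          ys = rev (take t \<tau>)
      in accepts (sample_end n) (large_end n) (real_of_rat W) s v
           (run (sample_end n) (large_end n) (real_of_rat W) s v ys) ys (\<tau> ! t))"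

definition tagged_algorithm :: randomized_algorithm where
  "tagged_algorithm n W = map_pmf (tagged_rule n W) (pmf_of_set (permutations_of_set {1..n}))"

text \<open>Turns the recursion on the latest arrival into a comprehension over rounds, the form of
  \<open>packed_items\<close>.\<close>

lemma run_rev_eq:
  "run a b W s v (rev \<tau>) = (!) \<tau> ` {t. t < length \<tau> \<and>
     accepts a b W s v (run a b W s v (rev (take t \<tau>))) (rev (take t \<tau>)) (\<tau> ! t)}"
proof (induction \<tau> rule: rev_induct)
  case (snoc x xs)
  define P where "P \<tau> t \<longleftrightarrow> accepts a b W s v (run a b W s v (rev (take t \<tau>))) (rev (take t \<tau>)) (\<tau> ! t)"
    for \<tau> t
  have IH: "run a b W s v (rev xs) = (!) xs ` {t. t < length xs \<and> P xs t}"
    unfolding P_def by (rule snoc.IH)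
  have P: "P (xs @ [x]) t = P xs t" if "t < length xs" for t
    using that by (simp add: P_def nth_append)
  have "{t. t < length (xs @ [x]) \<and> P (xs @ [x]) t} =
      {t. t < length xs \<and> P xs t} \<union> (if P (xs @ [x]) (length xs) then {length xs} else {})"
    using P by (auto simp: less_Suc_eq)
  then have "(!) (xs @ [x]) ` {t. t < length (xs @ [x]) \<and> P (xs @ [x]) t} =
      (!) (xs @ [x]) ` {t. t < length xs \<and> P xs t} \<union> (if P (xs @ [x]) (length xs) then {x} else {})"
    by (simp add: image_Un)
  also have "(!) (xs @ [x]) ` {t. t < length xs \<and> P xs t} = (!) xs ` {t. t < length xs \<and> P xs t}"
    by (intro image_cong) (auto simp: nth_append)
  also have "\<dots> \<union> (if P (xs @ [x]) (length xs) then {x} else {}) = run a b W s v (rev (xs @ [x]))"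
    unfolding IH[symmetric] by (simp add: P_def)
  finally show ?case unfolding P_def by (rule sym)
qed simp

text \<open>The table \<open>val\<close> agrees with \<open>f\<close> on the tags used so far, the
  current one included. By the congruence lemmas its values elsewhere do not matter.\<close>

lemma tagged_rule_map:
  fixes f :: "nat \<Rightarrow> rat \<times> rat"
  assumes t: "t < length \<tau>"
  defines "s \<equiv> \<lambda>j. real_of_rat (fst (f j))" and "v \<equiv> \<lambda>j. real_of_rat (snd (f j))"
  shows "tagged_rule n W \<tau> (map f (take t \<tau>)) (f (\<tau> ! t)) \<longleftrightarrow>
    accepts (sample_end n) (large_end n) (real_of_rat W) s v
      (run (sample_end n) (large_end n) (real_of_rat W) s v (rev (take t \<tau>))) (rev (take t \<tau>)) (\<tau> ! t)"
proof -
  define val where "val = map_of (zip (take (Suc t) \<tau>) (map f (take t \<tau>) @ [f (\<tau> ! t)]))"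
  define s' where "s' = (\<lambda>j. real_of_rat (fst (the (val j))))"
  define v' where "v' = (\<lambda>j. real_of_rat (snd (the (val j))))"
  have take: "take (Suc t) \<tau> = take t \<tau> @ [\<tau> ! t]" using t by (rule take_Suc_conv_app_nth)
  then have "map f (take t \<tau>) @ [f (\<tau> ! t)] = map f (take (Suc t) \<tau>)" by simp
  then have val: "val j = Some (f j)" if "j \<in> set (take (Suc t) \<tau>)" for j
    unfolding val_def using that by (simp add: map_of_zip_map)
  have sv: "s' j = s j" "v' j = v j" if "j \<in> set (\<tau> ! t # rev (take t \<tau>))" for j
  proof -
    have "j \<in> set (take (Suc t) \<tau>)" using that unfolding take by auto
    from val[OF this] show "s' j = s j" "v' j = v j" by (simp_all add: s'_def v'_def s_def v_def)
  qed
  have len: "length (map f (take t \<tau>)) = t" using t by simp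
  have run: "run a b w s' v' (rev (take t \<tau>)) = run a b w s v (rev (take t \<tau>))" for a b w
    by (rule run_cong) (simp_all add: sv)
  show ?thesis
    unfolding tagged_rule_def Let_def len val_def[symmetric] s'_def[symmetric] v'_def[symmetric] run
    by (rule accepts_cong[OF sv run_subset])
qed

text \<open>If the items arrive in the order \<open>map \<rho> \<tau>\<close>, tag \<open>j\<close>
  stands for item \<open>\<rho> j\<close>; the rule simulates the algorithm on tags, with sizes and
  profits pulled back along \<open>\<rho>\<close>.\<close>

lemma packed_items_tagged_rule:
  "packed_items (tagged_rule n W \<tau>) s v (map \<rho> \<tau>) =
    \<rho> ` run (sample_end n) (large_end n) (real_of_rat W)
      (\<lambda>j. real_of_rat (s (\<rho> j))) (\<lambda>j. real_of_rat (v (\<rho> j))) (rev \<tau>)"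
proof -
  let ?D = "\<lambda>t. tagged_rule n W \<tau> (map (\<lambda>j. (s j, v j)) (take t (map \<rho> \<tau>)))
      (s (map \<rho> \<tau> ! t), v (map \<rho> \<tau> ! t))"
  let ?f = "\<lambda>j. (s (\<rho> j), v (\<rho> j))"
  let ?A = "\<lambda>t. accepts (sample_end n) (large_end n) (real_of_rat W)
     (\<lambda>j. real_of_rat (s (\<rho> j))) (\<lambda>j. real_of_rat (v (\<rho> j)))
     (run (sample_end n) (large_end n) (real_of_rat W)
       (\<lambda>j. real_of_rat (s (\<rho> j))) (\<lambda>j. real_of_rat (v (\<rho> j))) (rev (take t \<tau>)))
     (rev (take t \<tau>)) (\<tau> ! t)"
  have D: "?D t = ?A t" if t: "t < length \<tau>" for t
  proof -
    have "?D t = tagged_rule n W \<tau> (map ?f (take t \<tau>)) (?f (\<tau> ! t))"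
      using t by (simp add: take_map o_def)
    then show ?thesis
      using tagged_rule_map[OF t, of n W ?f] by (simp only: fst_conv snd_conv)
  qed
  have "{t. t < length \<tau> \<and> ?D t} = {t. t < length \<tau> \<and> ?A t}"
    by (rule Collect_cong, rule conj_cong[OF refl]) (rule D)
  then have "packed_items (tagged_rule n W \<tau>) s v (map \<rho> \<tau>) = (!) (map \<rho> \<tau>) ` {t. t < length \<tau> \<and> ?A t}"
    by (simp only: packed_items_def setcompr_eq_image length_map)
  also have "\<dots> = \<rho> ` (!) \<tau> ` {t. t < length \<tau> \<and> ?A t}"
    unfolding image_image by (rule image_cong[OF refl]) simp
  finally show ?thesis unfolding run_rev_eq[of _ _ _ _ _ \<tau>] .
qed

text \<open>Injective because \<open>\<tau>\<close> lists all of \<open>A\<close>; both sides have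
  \<open>fact (card A)\<close> elements.\<close>

lemma map_perm_bij:
  assumes "\<tau> \<in> permutations_of_set A" "finite A"
  shows "bij_betw (\<lambda>\<rho>. map \<rho> \<tau>) {\<rho>. \<rho> permutes A} (permutations_of_set A)"
proof -
  have inj: "inj_on (\<lambda>\<rho>. map \<rho> \<tau>) {\<rho>. \<rho> permutes A}"
  proof (rule inj_onI, rule ext)
    fix \<rho> \<rho>' x assume "\<rho> \<in> {\<rho>. \<rho> permutes A}" "\<rho>' \<in> {\<rho>. \<rho> permutes A}" "map \<rho> \<tau> = map \<rho>' \<tau>"
    then show "\<rho> x = \<rho>' x" using assms
      by (cases "x \<in> A") (auto simp: permutations_of_set_def permutes_not_in)
  qed
  have sub: "(\<lambda>\<rho>. map \<rho> \<tau>) ` {\<rho>. \<rho> permutes A} \<subseteq> permutations_of_set A"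
  proof clarify
    fix \<rho> assume "\<rho> permutes A"
    from permutations_of_set_image_permutes[OF this] show "map \<rho> \<tau> \<in> permutations_of_set A"
      using assms(1) by blast
  qed
  have "card ((\<lambda>\<rho>. map \<rho> \<tau>) ` {\<rho>. \<rho> permutes A}) = card (permutations_of_set A)"
    using assms by (simp add: card_image[OF inj] card_permutations)
  then have "(\<lambda>\<rho>. map \<rho> \<tau>) ` {\<rho>. \<rho> permutes A} = permutations_of_set A"
    using sub by (intro card_subset_eq) auto
  then show ?thesis using inj by (simp add: bij_betw_def)
qed

text \<open>For any tags \<open>\<tau>\<close>, every arrival order is
  \<open>map \<rho> \<tau>\<close> for some permutation \<open>\<rho>\<close>, so feasibility
  carries over from \<open>run\<close> for every outcome of the randomness.\<close>

lemma online_tagged_algorithm: "online_knapsack_algorithm tagged_algorithm"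
  unfolding online_knapsack_algorithm_def
proof (intro allI impI ballI)
  fix n W s v D \<pi>
  assume inst: "knapsack_instance n W s v" and D: "D \<in> set_pmf (tagged_algorithm n W)"
    and \<pi>: "\<pi> \<in> permutations_of_set {1..n}"
  obtain \<tau> where \<tau>: "\<tau> \<in> permutations_of_set {1..n}" "D = tagged_rule n W \<tau>"
    using D by (auto simp: tagged_algorithm_def)
  then obtain \<rho> where \<rho>: "\<rho> permutes {1..n}" "\<pi> = map \<rho> \<tau>"
    using bij_betw_imp_surj_on[OF map_perm_bij[OF \<tau>(1)]] \<pi> by blast
  let ?R = "run (sample_end n) (large_end n) (real_of_rat W)
      (\<lambda>j. real_of_rat (s (\<rho> j))) (\<lambda>j. real_of_rat (v (\<rho> j))) (rev \<tau>)"
  have d: "distinct \<tau>" "set \<tau> = {1..n}" using \<tau> by (auto dest: permutations_of_setD)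
  have P: "packed_items D s v \<pi> = \<rho> ` ?R"
    unfolding \<tau>(2) \<rho>(2) by (rule packed_items_tagged_rule)
  have "?R \<subseteq> set (rev \<tau>)" by (rule run_subset)
  then have "?R \<subseteq> {1..n}" unfolding set_rev d(2) .
  then have sub: "\<rho> ` ?R \<subseteq> {1..n}"
    using image_mono[of ?R "{1..n}" \<rho>] permutes_image[OF \<rho>(1)] by simp
  have W: "0 < real_of_rat W" using inst by (simp add: knapsack_instance_def)
  have "real_of_rat (\<Sum>i\<in>\<rho> ` ?R. s i) = (\<Sum>i\<in>?R. real_of_rat (s (\<rho> i)))"
    using inj_on_subset[OF permutes_inj[OF \<rho>(1)] subset_UNIV]
    by (subst sum.reindex) (simp_all add: of_rat_sum)
  also have "\<dots> \<le> real_of_rat W" using d W by (intro sum_run_le) auto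
  finally have "(\<Sum>i\<in>\<rho> ` ?R. s i) \<le> W" by (simp only: of_rat_less_eq)
  then show "is_packing n W s (packed_items D s v \<pi>)"
    unfolding is_packing_def P using sub by (intro conjI)
qed

text \<open>Writing the arrival order as \<open>map \<rho> \<tau>\<close> makes the renaming \<open>\<rho>\<close> and the tags \<open>\<tau>\<close> independent; the
  latter then play the role of the arrival order.\<close>

lemma expected_profit_tagged:
  "expected_profit tagged_algorithm n W s v =
     (\<Sum>\<rho> | \<rho> permutes {1..n}. perm_avg {1..n} (\<lambda>ys. sum (\<lambda>j. real_of_rat (v (\<rho> j)))
       (run (sample_end n) (large_end n) (real_of_rat W)
         (\<lambda>j. real_of_rat (s (\<rho> j))) (\<lambda>j. real_of_rat (v (\<rho> j))) ys))) / fact n"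
proof -
  let ?P = "permutations_of_set {1..n}"
  let ?F = "\<lambda>\<tau> \<pi>. real_of_rat (profit v (packed_items (tagged_rule n W \<tau>) s v \<pi>))"
  let ?g = "\<lambda>\<rho> ys. sum (\<lambda>j. real_of_rat (v (\<rho> j))) (run (sample_end n) (large_end n) (real_of_rat W)
         (\<lambda>j. real_of_rat (s (\<rho> j))) (\<lambda>j. real_of_rat (v (\<rho> j))) ys)"
  have "expected_profit tagged_algorithm n W s v =
    measure_pmf.expectation (pair_pmf (pmf_of_set ?P) (pmf_of_set ?P)) (\<lambda>(\<tau>, \<pi>). ?F \<tau> \<pi>)"
    unfolding expected_profit_def tagged_algorithm_def pair_map_pmf1 integral_map_pmf
    by (simp add: case_prod_unfold)
  also have "\<dots> = (\<Sum>(\<tau>, \<pi>)\<in>?P \<times> ?P. ?F \<tau> \<pi> * pmf (pair_pmf (pmf_of_set ?P) (pmf_of_set ?P)) (\<tau>, \<pi>))"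
    by (subst integral_measure_pmf_real[of "?P \<times> ?P"]) (auto simp: case_prod_unfold)
  also have "\<dots> = (\<Sum>(\<tau>, \<pi>)\<in>?P \<times> ?P. ?F \<tau> \<pi> / (fact n * fact n))"
    by (rule sum.cong[OF refl]) (auto simp: pmf_pair)
  also have "\<dots> = (\<Sum>\<tau>\<in>?P. \<Sum>\<pi>\<in>?P. ?F \<tau> \<pi>) / (fact n * fact n)"
    by (simp add: sum.cartesian_product sum_divide_distrib case_prod_unfold)
  \<comment> \<open>For fixed tags, \<open>\<pi> = map \<rho> \<tau>\<close> turns the sum over
    arrival orders into one over renamings.\<close>
  also have "(\<Sum>\<tau>\<in>?P. \<Sum>\<pi>\<in>?P. ?F \<tau> \<pi>) = (\<Sum>\<tau>\<in>?P. \<Sum>\<rho> | \<rho> permutes {1..n}. ?F \<tau> (map \<rho> \<tau>))"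
    by (rule sum.cong[OF refl], rule sum.reindex_bij_betw[symmetric], rule map_perm_bij) auto
  also have "\<dots> = (\<Sum>\<tau>\<in>?P. \<Sum>\<rho> | \<rho> permutes {1..n}. ?g \<rho> (rev \<tau>))"
  proof (rule sum.cong[OF refl], rule sum.cong[OF refl])
    fix \<tau> \<rho> assume \<tau>: "\<tau> \<in> ?P" and \<rho>: "\<rho> \<in> {\<rho>. \<rho> permutes {1..n}}"
    have inj: "inj_on \<rho> B" for B using \<rho> permutes_inj inj_on_subset by blast
    show "?F \<tau> (map \<rho> \<tau>) = ?g \<rho> (rev \<tau>)"
      unfolding packed_items_tagged_rule profit_def
      by (subst sum.reindex[OF inj]) (simp add: of_rat_sum)
  qed
  also have "\<dots> = (\<Sum>\<rho> | \<rho> permutes {1..n}. \<Sum>\<tau>\<in>?P. ?g \<rho> (rev \<tau>))"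
    by (rule sum.swap)
  \<comment> \<open>\<open>run\<close> expects the latest arrival first; reversal permutes the set
    of orders.\<close>
  also have "\<dots> = (\<Sum>\<rho> | \<rho> permutes {1..n}. \<Sum>\<tau>\<in>?P. ?g \<rho> \<tau>)"
  proof (rule sum.cong[OF refl])
    fix \<rho>
    show "(\<Sum>\<tau>\<in>?P. ?g \<rho> (rev \<tau>)) = (\<Sum>\<tau>\<in>?P. ?g \<rho> \<tau>)"
      using sum.reindex[of rev ?P "?g \<rho>"] by (simp add: o_def inj_on_def)
  qed
  also have "\<dots> = (\<Sum>\<rho> | \<rho> permutes {1..n}. perm_avg {1..n} (?g \<rho>)) * fact n"
    by (simp add: perm_avg_def sum_divide_distrib[symmetric])
  finally show ?thesis by simp
qed

section \<open>The competitive ratio\<close>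

lemma OPT_attained:
  assumes "knapsack_instance n W s v"
  obtains M where "is_packing n W s M" "OPT n W s v = profit v M"
proof -
  let ?F = "{M. is_packing n W s M}"
  have "finite ?F" by (rule finite_subset[of _ "Pow {1..n}"]) (auto simp: is_packing_def)
  moreover have "{} \<in> ?F" using assms by (simp add: is_packing_def knapsack_instance_def)
  ultimately have "OPT n W s v \<in> profit v ` ?F"
    unfolding OPT_def by (intro Max_in) auto
  then show thesis using that by auto
qed

text \<open>The guarantee holds for each renaming \<open>\<rho>\<close> separately, against the same
  optimum, and is then averaged over all renamings.\<close>

lemma tagged_algorithm_competitive:
  assumes inst: "knapsack_instance n W s v" and good: "good_length n"
  shows "1 / 6.65 * real_of_rat (OPT n W s v) \<le> expected_profit tagged_algorithm n W s v"
proof -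
  let ?\<alpha> = "1 / 6.65 :: real"
  obtain M where M: "is_packing n W s M" "OPT n W s v = profit v M"
    using OPT_attained[OF inst] .
  have "?\<alpha> * real_of_rat (OPT n W s v) \<le> perm_avg {1..n} (\<lambda>ys. sum (\<lambda>j. real_of_rat (v (\<rho> j)))
       (run (sample_end n) (large_end n) (real_of_rat W)
         (\<lambda>j. real_of_rat (s (\<rho> j))) (\<lambda>j. real_of_rat (v (\<rho> j))) ys))"
    if \<rho>: "\<rho> permutes {1..n}" for \<rho>
  proof -
    interpret knapsack_items "sample_end n" "large_end n" "real_of_rat W"
      "\<lambda>j. real_of_rat (s (\<rho> j))" "\<lambda>j. real_of_rat (v (\<rho> j))" "{1..n}"
    proof
      fix i assume "i \<in> {1..n}"
      then have "\<rho> i \<in> {1..n}" unfolding permutes_in_image[OF \<rho>] .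
      then show "0 < real_of_rat (s (\<rho> i))" "real_of_rat (s (\<rho> i)) \<le> real_of_rat W"
        "0 \<le> real_of_rat (v (\<rho> i))"
        using inst by (simp_all add: knapsack_instance_def of_rat_less_eq)
    qed (use inst good_lengthD(1-3)[OF good] in \<open>simp_all add: knapsack_instance_def\<close>)
    have inj: "inj_on (inv \<rho>) B" for B
      using permutes_inj[OF permutes_inv[OF \<rho>]] inj_on_subset by blast
    have inv: "\<rho> (inv \<rho> i) = i" for i using \<rho> by (rule permutes_inverses)
    let ?T = "inv \<rho> ` M"
    have T: "?T \<subseteq> {1..n}"
      using M(1) image_mono[of M "{1..n}" "inv \<rho>"] permutes_image[OF permutes_inv[OF \<rho>]]
      by (simp add: is_packing_def)
    have sum: "(\<Sum>j\<in>?T. real_of_rat (f (\<rho> j))) = real_of_rat (sum f M)" for f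
      by (subst sum.reindex[OF inj]) (simp add: of_rat_sum inv)
    have size: "(\<Sum>j\<in>?T. real_of_rat (s (\<rho> j))) \<le> real_of_rat W"
      using M(1) unfolding sum by (simp add: is_packing_def of_rat_less_eq)
    have "?\<alpha> * (\<Sum>j\<in>?T. real_of_rat (v (\<rho> j))) \<le> perm_avg {1..n} (\<lambda>ys. sum (\<lambda>j. real_of_rat (v (\<rho> j)))
       (run (sample_end n) (large_end n) (real_of_rat W)
         (\<lambda>j. real_of_rat (s (\<rho> j))) (\<lambda>j. real_of_rat (v (\<rho> j))) ys))"
      by (rule competitive[unfolded card_atLeastAtMost diff_Suc_1, OF _ good_lengthD(4-7)[OF good] T size]) simp
    then show ?thesis unfolding sum M(2) profit_def .
  qed
  then have "(\<Sum>\<rho> | \<rho> permutes {1..n}. ?\<alpha> * real_of_rat (OPT n W s v)) \<le>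
     (\<Sum>\<rho> | \<rho> permutes {1..n}. perm_avg {1..n} (\<lambda>ys. sum (\<lambda>j. real_of_rat (v (\<rho> j)))
       (run (sample_end n) (large_end n) (real_of_rat W)
         (\<lambda>j. real_of_rat (s (\<rho> j))) (\<lambda>j. real_of_rat (v (\<rho> j))) ys)))"
    by (intro sum_mono) auto
  then have "fact n * (?\<alpha> * real_of_rat (OPT n W s v)) \<le> fact n * expected_profit tagged_algorithm n W s v"
    unfolding expected_profit_tagged by (simp add: card_permutations)
  then show ?thesis by simp
qed

text \<open>Settles the lengths that are not good, where the claimed ratio is 0.\<close>

lemma expected_profit_nonneg:
  assumes "knapsack_instance n W s v"
  shows "0 \<le> expected_profit tagged_algorithm n W s v"
proof -
  have v: "0 \<le> real_of_rat (v (\<rho> j))" if "\<rho> permutes {1..n}" "j \<in> {1..n}" for \<rho> j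
  proof -
    have "\<rho> j \<in> {1..n}" using permutes_in_image[OF that(1)] that(2) by blast
    then show ?thesis using assms by (simp add: knapsack_instance_def)
  qed
  show ?thesis
    unfolding expected_profit_tagged
  proof (intro divide_nonneg_nonneg sum_nonneg perm_avg_nonneg)
    fix \<rho> ys j
    assume "\<rho> \<in> {\<rho>. \<rho> permutes {1..n}}" "set ys = {1..n}"
      and "j \<in> run (sample_end n) (large_end n) (real_of_rat W)
         (\<lambda>j. real_of_rat (s (\<rho> j))) (\<lambda>j. real_of_rat (v (\<rho> j))) ys"
    then show "0 \<le> real_of_rat (v (\<rho> j))" using v[of \<rho> j] run_subset[of _ _ _ _ _ ys] by blast
  qed simp
qed

theorem theorem1:
  "\<exists>A :: randomized_algorithm. online_knapsack_algorithm A \<and>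
     (\<exists>\<epsilon> :: nat \<Rightarrow> real. \<epsilon> \<in> o(\<lambda>_. 1) \<and>
        (\<forall>n W s v. knapsack_instance n W s v \<longrightarrow>
           expected_profit A n W s v \<ge> (1 / 6.65 - \<epsilon> n) * real_of_rat (OPT n W s v)))"
proof (intro exI conjI allI impI)
  let ?\<epsilon> = "\<lambda>n. if good_length n then 0 else 1 / 6.65 :: real"
  show "online_knapsack_algorithm tagged_algorithm" by (rule online_tagged_algorithm)
  have "\<forall>\<^sub>F n in sequentially. ?\<epsilon> n = 0"
    using eventually_good_length by eventually_elim simp
  then have "?\<epsilon> \<longlonglongrightarrow> 0" by (rule tendsto_eventually)
  then show "?\<epsilon> \<in> o(\<lambda>_. 1)" by (intro smalloI_tendsto) simp_all
  fix n W s v assume inst: "knapsack_instance n W s v"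
  show "(1 / 6.65 - ?\<epsilon> n) * real_of_rat (OPT n W s v) \<le> expected_profit tagged_algorithm n W s v"
    using tagged_algorithm_competitive[OF inst] expected_profit_nonneg[OF inst] by auto
qed

end
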